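(* Assume (H1)–(H4). Let $u\in C(\mathbb{R}^n\times[0,T))$ be a viscosity solution of (1.1)–(1.2). Then: (i) if $(C_1,K_3)\ne(0,0)$, for all $(x,t)\in\mathbb{R}^n\times(0,T)$ and $p\in D_x^-u(x,t)$, $$\underline{I}(x,t;u_0)e^{-(C_1+K_3)t}-\frac{C_1\beta}{C_1+K_3}\big(1-e^{-(C_1+K_3)t}\big)\le|p|\le\overline{S}(x,t;u_0)e^{(C_1+K_3)t}+\frac{C_1\beta}{C_1+K_3}\big(e^{(C_1+K_3)t}-1\big);$$ (ii) if $(C_1,K_3)=(0,0)$, then $\underline{I}(x,t;u_0)\le|p|\le\overline{S}(x,t;u_0)$ for all $(x,t)\in\mathbb{R}^n\times(0,T)$ and $p\in D_x^-u(x,t)$.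
   Context: Let $T>0$, $n\ge1$. $H:\mathbb{R}^n\times[0,T]\times\mathbb{R}\times\mathbb{R}^n\to\mathbb{R}$ continuous, $u_0$ Lipschitz. Problem (1.1)–(1.2): $u_t+H(x,t,u,D_xu)=0$ in $\mathbb{R}^n\times(0,T)$, $u(x,0)=u_0(x)$. (H1) there exist $C_1\ge0$, $\beta\in\{0,1\}$ with $|H(x,t,u,p)-H(y,t,u,p)|\le C_1(\beta+|p|)|x-y|$. (H2) there exist $A_2,B_2\ge0$ with $|H(x,t,u,p)-H(x,t,u,q)|\le(A_2|x|+B_2)|p-q|$. (H3) there exists $K_3\ge0$ with $|H(x,t,u,p)-H(x,t,v,p)|\le K_3|u-v|$. (H4) $p\mapsto H(x,t,u,p)$ convex. (All for all arguments.) Viscosity solution: $u\in C(\mathbb{R}^n\times[0,T))$, $u(\cdot,0)=u_0$, and for every $\phi\in C^1(\mathbb{R}^n\times(0,T))$, if $u-\phi$ has a local max (resp. min) at $(x,t)\in\mathbb{R}^n\times(0,T)$ then $\phi_t+H(x,t,u(x,t),D_x\phi(x,t))\le0$ (resp. $\ge0$). $D^-f(x)=\{D\phi(x):\phi\in C^1,\ f-\phi$ has a local min at $x\}$; $D_x^-u(x,t)=\{p:(p,\tau)\in D^-u(x,t)\}$. $R(x,t)=(\frac{B_2}{A_2}+|x|)(e^{A_2t}-1)$ if $A_2>0$, $=B_2t$ if $A_2=0$. $\overline{S}(x,t;u_0)=\lim_{\delta\to0^+}\sup\{|p|:p\in D^-u_0(y),\ y\in\overline{B_{R(x,t)+\delta}(x)}\}$,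 $\underline{I}(x,t;u_0)=\lim_{\delta\to0^+}\inf\{|p|:p\in D^-u_0(y),\ y\in\overline{B_{R(x,t)+\delta}(x)}\}$. *)

theory Defs
  imports "HOL-Analysis.Analysis"
begin

text \<open>Points of R^n are elements of an arbitrary euclidean space 'a; space-time points
are pairs ('a \<times> real), whose inner product is (p,\<tau>)\<bullet>(h,s) = p\<bullet>h + \<tau> s.
A function phi is C^1 on an open set S with gradient G if it has Frechet derivative
h \<mapsto> G z \<bullet> h at every z in S and G is continuous on S.\<close>

definition C1_grad_on :: "'b::euclidean_space set \<Rightarrow> ('b \<Rightarrow> real) \<Rightarrow> ('b \<Rightarrow> 'b) \<Rightarrow> bool" where
  "C1_grad_on S \<phi> G \<longleftrightarrow>
     (\<forall>z\<in>S. (\<phi> has_derivative (\<lambda>h. G z \<bullet> h)) (at z)) \<and> continuous_on S G"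

definition subdiff_on :: "'b::euclidean_space set \<Rightarrow> ('b \<Rightarrow> real) \<Rightarrow> 'b \<Rightarrow> 'b set" where
  "subdiff_on S f z = {p. \<exists>\<phi> G. C1_grad_on S \<phi> G \<and> G z = p \<and>
      (\<exists>e>0. \<forall>y\<in>ball z e \<inter> S. f y - \<phi> y \<ge> f z - \<phi> z)}"

abbreviation subdiff :: "('a::euclidean_space \<Rightarrow> real) \<Rightarrow> 'a \<Rightarrow> 'a set" where
  "subdiff f y \<equiv> subdiff_on UNIV f y"

definition subdiff_x :: "real \<Rightarrow> ('a::euclidean_space \<Rightarrow> real \<Rightarrow> real) \<Rightarrow> 'a \<Rightarrow> real \<Rightarrow> 'a set" where
  "subdiff_x T u x t = fst ` subdiff_on (UNIV \<times> {0<..<T}) (\<lambda>(y,s). u y s) (x,t)"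

definition viscosity_solution ::
  "real \<Rightarrow> ('a::euclidean_space \<Rightarrow> real \<Rightarrow> real \<Rightarrow> 'a \<Rightarrow> real) \<Rightarrow> ('a \<Rightarrow> real)
     \<Rightarrow> ('a \<Rightarrow> real \<Rightarrow> real) \<Rightarrow> bool" where
  "viscosity_solution T H u0 u \<longleftrightarrow>
     continuous_on (UNIV \<times> {0..<T}) (\<lambda>(x,t). u x t) \<and>
     (\<forall>x. u x 0 = u0 x) \<and>
     (\<forall>\<phi> G x t. C1_grad_on (UNIV \<times> {0<..<T}) \<phi> G \<and> 0 < t \<and> t < T \<longrightarrow>
        ((\<exists>e>0. \<forall>z\<in>ball (x,t) e \<inter> (UNIV \<times> {0<..<T}).
              (\<lambda>(y,s). u y s) z - \<phi> z \<le> u x t - \<phi> (x,t))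
           \<longrightarrow> snd (G (x,t)) + H x t (u x t) (fst (G (x,t))) \<le> 0) \<and>
        ((\<exists>e>0. \<forall>z\<in>ball (x,t) e \<inter> (UNIV \<times> {0<..<T}).
              (\<lambda>(y,s). u y s) z - \<phi> z \<ge> u x t - \<phi> (x,t))
           \<longrightarrow> snd (G (x,t)) + H x t (u x t) (fst (G (x,t))) \<ge> 0))"

definition Rfun :: "real \<Rightarrow> real \<Rightarrow> 'a::euclidean_space \<Rightarrow> real \<Rightarrow> real" where
  "Rfun A2 B2 x t = (if A2 > 0 then (B2 / A2 + norm x) * (exp (A2 * t) - 1) else B2 * t)"

definition Sbar :: "real \<Rightarrow> real \<Rightarrow> ('a::euclidean_space \<Rightarrow> real) \<Rightarrow> 'a \<Rightarrow> real \<Rightarrow> real" where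
  "Sbar A2 B2 u0 x t = Lim (at_right 0) (\<lambda>\<delta>.
      Sup {norm p | p y. p \<in> subdiff u0 y \<and> y \<in> cball x (Rfun A2 B2 x t + \<delta>)})"

definition Ibar :: "real \<Rightarrow> real \<Rightarrow> ('a::euclidean_space \<Rightarrow> real) \<Rightarrow> 'a \<Rightarrow> real \<Rightarrow> real" where
  "Ibar A2 B2 u0 x t = Lim (at_right 0) (\<lambda>\<delta>.
      Inf {norm p | p y. p \<in> subdiff u0 y \<and> y \<in> cball x (Rfun A2 B2 x t + \<delta>)})"

end

theory Submission
  imports Defs
begin

text \<open>
  Both estimates come from comparing \<open>u\<close> with its extrema over balls of moving radius. If
  \<open>|Du\<^sub>0| \<le> S\<close>, let \<open>w(x,t) = max {u(z,t) : |z - x| \<le> \<rho>(t)} - m(t) \<rho>(t)\<close> with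
  \<open>\<rho>' = - C\<^sub>1 \<rho>\<close>. The maximising displacement is parallel to the gradient of a test function, so the
  change of radius absorbs the term \<open>C\<^sub>1 |p| \<rho>\<close> of (H1), and \<open>w\<close> is a subsolution as soon as
  \<open>m' = (C\<^sub>1 + K\<^sub>3) m + C\<^sub>1 \<beta>\<close>. A comparison principle in the domain of dependence given by (H2) yields
  \<open>w \<le> u\<close>, which is the upper bound as \<open>\<rho> \<rightarrow> 0\<close>. The lower bound is the same argument for
  \<open>w(x,t) = min {u(z,t) : |z - x| \<le> \<rho>(t)} + m(t) \<rho>(t)\<close>: the bound \<open>|Du\<^sub>0| \<ge> I\<close> means that \<open>u\<^sub>0\<close>
  descends by \<open>I \<rho>\<close> inside every ball of radius \<open>\<rho>\<close>. A minimum of subsolutions has to be tested from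
  below, and this is where convexity enters: for functions that are Lipschitz in space, which the
  upper bound provides, testing from below and from above are equivalent (Barron and Jensen).
\<close>

section \<open>Test functions\<close>

text \<open>Moving a point by at most \<rho> changes H by up to C1 \<rho> (\<beta> + |p|). The
  gradient p of a test function is not bounded in advance, so the part C1 \<rho> |p| has to be
  cancelled by what a changing radius adds to the time derivative; this dictates \<rho>. For the
  minimum the sign turns and the radius grows: \<rho>' = C1 \<rho>. With \<eta> = m \<rho>, (H3)
  costs K3 |\<eta>| and differentiating \<rho> contributes C1 m \<rho>, whence the exponent C1 + K3.
  The cost is |\<eta>| rather than \<eta>, so the lower bound is run only while m is nonnegative;
  where its left-hand side is not positive it is trivial. Convexity is used twice: - u is put into
  the sense of Barron and Jensen, its moving supremum is formed, and the result is turned back,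
  because comparison with u needs testing from above. Subgradients of u0 need not exist everywhere,
  so bounds on them are first converted into bounds on increments of u0 by penalised
  extrema.\<close>

lemma C1_grad_on_has_derivative:
  "C1_grad_on S \<phi> G \<Longrightarrow> z \<in> S \<Longrightarrow> (\<phi> has_derivative (\<lambda>h. G z \<bullet> h)) (at z)"
  by (simp add: C1_grad_on_def)

lemma C1_grad_on_const: "C1_grad_on S (\<lambda>z. c) (\<lambda>z. 0)"
  by (auto simp: C1_grad_on_def)

lemma C1_grad_on_inner: "C1_grad_on S (\<lambda>z. (z - a) \<bullet> w) (\<lambda>z. w)"
  unfolding C1_grad_on_def
  by (auto intro!: derivative_eq_intros simp: inner_commute)

lemma C1_grad_on_norm_sq: "C1_grad_on S (\<lambda>z. (norm (z - a))\<^sup>2) (\<lambda>z. 2 *\<^sub>R (z - a))"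
  unfolding C1_grad_on_def power2_norm_eq_inner
  by (auto intro!: derivative_eq_intros continuous_intros simp: inner_commute)

lemma C1_grad_on_add:
  "C1_grad_on S \<phi> G \<Longrightarrow> C1_grad_on S \<psi> G' \<Longrightarrow> C1_grad_on S (\<lambda>z. \<phi> z + \<psi> z) (\<lambda>z. G z + G' z)"
  unfolding C1_grad_on_def
  by (auto intro!: derivative_eq_intros continuous_intros simp: inner_add_left)

lemma C1_grad_on_imp_continuous_on: "C1_grad_on S \<phi> G \<Longrightarrow> continuous_on S \<phi>"
  unfolding C1_grad_on_def
  by (auto intro!: has_derivative_continuous_on intro: has_derivative_at_withinI)

lemma C1_grad_on_mult:
  assumes "C1_grad_on S \<phi> G" "C1_grad_on S \<psi> G'"
  shows "C1_grad_on S (\<lambda>z. \<phi> z * \<psi> z) (\<lambda>z. \<phi> z *\<^sub>R G' z + \<psi> z *\<^sub>R G z)"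
  using assms C1_grad_on_imp_continuous_on[OF assms(1)] C1_grad_on_imp_continuous_on[OF assms(2)]
  unfolding C1_grad_on_def
  by (auto intro!: derivative_eq_intros continuous_intros simp: inner_add_left algebra_simps)

lemma C1_grad_on_cmult:
  "C1_grad_on S \<phi> G \<Longrightarrow> C1_grad_on S (\<lambda>z. c * \<phi> z) (\<lambda>z. c *\<^sub>R G z)"
  using C1_grad_on_mult[OF C1_grad_on_const[of S c]] by simp

lemma C1_grad_on_uminus:
  "C1_grad_on S \<phi> G \<Longrightarrow> C1_grad_on S (\<lambda>z. - \<phi> z) (\<lambda>z. - G z)"
  using C1_grad_on_cmult[of S \<phi> G "-1"] by simp

lemma C1_grad_on_compose:
  assumes "C1_grad_on S \<phi> G" and "\<And>z. z \<in> S \<Longrightarrow> (h has_real_derivative h' (\<phi> z)) (at (\<phi> z))"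
    and "continuous_on (\<phi> ` S) h'"
  shows "C1_grad_on S (\<lambda>z. h (\<phi> z)) (\<lambda>z. h' (\<phi> z) *\<^sub>R G z)"
  unfolding C1_grad_on_def
proof (intro conjI ballI)
  fix z assume "z \<in> S"
  then have "(\<phi> has_derivative (\<lambda>h. G z \<bullet> h)) (at z)"
    using assms(1) by (simp add: C1_grad_on_def)
  from has_derivative_compose[OF this has_field_derivative_imp_has_derivative[OF assms(2)[OF \<open>z \<in> S\<close>]]]
  show "((\<lambda>z. h (\<phi> z)) has_derivative (\<lambda>k. (h' (\<phi> z) *\<^sub>R G z) \<bullet> k)) (at z)"
    by simp
next
  show "continuous_on S (\<lambda>z. h' (\<phi> z) *\<^sub>R G z)"
    using assms(1,3) C1_grad_on_imp_continuous_on[OF assms(1)]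
    by (auto simp: C1_grad_on_def intro!: continuous_on_scaleR intro: continuous_on_compose2)
qed

lemma C1_grad_on_exp:
  "C1_grad_on S \<phi> G \<Longrightarrow> C1_grad_on S (\<lambda>z. exp (\<phi> z)) (\<lambda>z. exp (\<phi> z) *\<^sub>R G z)"
  by (rule C1_grad_on_compose) (auto intro!: derivative_eq_intros continuous_intros)

lemma C1_grad_on_sqrt:
  assumes "C1_grad_on S \<phi> G" "\<And>z. z \<in> S \<Longrightarrow> \<phi> z > 0"
  shows "C1_grad_on S (\<lambda>z. sqrt (\<phi> z)) (\<lambda>z. (inverse (sqrt (\<phi> z)) / 2) *\<^sub>R G z)"
proof (rule C1_grad_on_compose[OF assms(1)])
  show "(sqrt has_real_derivative inverse (sqrt (\<phi> z)) / 2) (at (\<phi> z))" if "z \<in> S" for z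
    using assms(2)[OF that] by (rule DERIV_real_sqrt)
  show "continuous_on (\<phi> ` S) (\<lambda>x. inverse (sqrt x) / 2)"
    using assms(2) by (intro continuous_intros) force+
qed

lemma C1_grad_on_fst_norm_sq:
  "C1_grad_on S (\<lambda>z. (norm (fst z - a))\<^sup>2) (\<lambda>z. (2 *\<^sub>R (fst z - a), 0 :: real))"
  unfolding C1_grad_on_def power2_norm_eq_inner
  by (auto intro!: derivative_eq_intros continuous_intros simp: inner_commute)

lemma C1_grad_on_snd: "C1_grad_on S (\<lambda>z :: 'a::euclidean_space \<times> real. snd z - s) (\<lambda>z. (0, 1))"
  unfolding C1_grad_on_def
  by (auto intro!: derivative_eq_intros continuous_intros)

lemma C1_grad_on_snd_sq:
  "C1_grad_on S (\<lambda>z :: 'a::euclidean_space \<times> real. (snd z - s)\<^sup>2) (\<lambda>z. (0, 2 * (snd z - s)))"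
  using C1_grad_on_mult[OF C1_grad_on_snd C1_grad_on_snd, of S s s] by (simp add: power2_eq_square)

text \<open>Pulls a test function back along a point that moves with speed \<rho>' in the fixed
  direction e. The chain rule puts - \<rho>' (e \<bullet> p) into the time component, the term that
  later absorbs C1 |p| \<rho>.\<close>

lemma C1_grad_on_shear:
  fixes \<phi> :: "'a::euclidean_space \<times> real \<Rightarrow> real"
  assumes C: "C1_grad_on (UNIV \<times> J) \<phi> G"
    and \<rho>: "\<And>t. (\<rho> has_real_derivative \<rho>' t) (at t)" "continuous_on UNIV \<rho>'"
  shows "C1_grad_on (UNIV \<times> J) (\<lambda>z. \<phi> (fst z - \<rho> (snd z) *\<^sub>R e, snd z))
    (\<lambda>z. (fst (G (fst z - \<rho> (snd z) *\<^sub>R e, snd z)),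
      snd (G (fst z - \<rho> (snd z) *\<^sub>R e, snd z)) - \<rho>' (snd z) * (e \<bullet> fst (G (fst z - \<rho> (snd z) *\<^sub>R e, snd z)))))"
  unfolding C1_grad_on_def
proof (intro conjI ballI)
  let ?X = "\<lambda>z. (fst z - \<rho> (snd z) *\<^sub>R e, snd z)"
  have "continuous_on UNIV \<rho>"
    by (intro continuous_at_imp_continuous_on ballI DERIV_isCont[OF \<rho>(1)])
  then have c: "continuous_on S (\<lambda>z. \<rho> (snd z))" "continuous_on S (\<lambda>z. \<rho>' (snd z))" for S :: "('a \<times> real) set"
    using \<rho>(2) by (auto intro: continuous_on_compose2 intro!: continuous_intros)
  have Gc: "continuous_on (UNIV \<times> J) G" using C by (simp add: C1_grad_on_def)
  have Xc: "continuous_on (UNIV \<times> J) ?X" by (intro continuous_intros c)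
  have GX: "continuous_on (UNIV \<times> J) (\<lambda>z. G (?X z))"
    by (rule continuous_on_compose2[OF Gc Xc]) auto
  show "continuous_on (UNIV \<times> J) (\<lambda>z. (fst (G (?X z)), snd (G (?X z)) - \<rho>' (snd z) * (e \<bullet> fst (G (?X z)))))"
    by (intro continuous_intros GX c)
  fix z :: "'a \<times> real" assume z: "z \<in> UNIV \<times> J"
  have "((\<lambda>z. \<rho> (snd z)) has_derivative (\<lambda>h. snd h * \<rho>' (snd z))) (at z)"
    using has_derivative_compose[OF _ \<rho>(1)[THEN has_field_derivative_imp_has_derivative], of snd snd z UNIV]
    by (simp add: has_derivative_snd mult.commute)
  then have "(?X has_derivative (\<lambda>h. (fst h - (snd h * \<rho>' (snd z)) *\<^sub>R e, snd h))) (at z)"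
    by (auto intro!: derivative_eq_intros)
  moreover have "(\<phi> has_derivative (\<lambda>h. G (?X z) \<bullet> h)) (at (?X z))"
    by (rule C1_grad_on_has_derivative[OF C]) (use z in auto)
  ultimately have "((\<lambda>z. \<phi> (?X z)) has_derivative (\<lambda>h. G (?X z) \<bullet> (fst h - (snd h * \<rho>' (snd z)) *\<^sub>R e, snd h))) (at z)"
    by (rule has_derivative_compose)
  then show "((\<lambda>z. \<phi> (?X z)) has_derivative (\<lambda>h. (fst (G (?X z)), snd (G (?X z)) - \<rho>' (snd z) * (e \<bullet> fst (G (?X z)))) \<bullet> h)) (at z)"
    by (rule has_derivative_eq_rhs)
      (auto simp: inner_prod_def inner_diff_right inner_diff_left algebra_simps inner_commute)
qed

section \<open>Functions with prescribed subgradients\<close>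

text \<open>One rate N meets both demands on a barrier: negligible on one side of a threshold,
  larger than a given bound on the other. Since \<open>exp x \<ge> 1 + x\<close>, an explicit N
  replaces a limit.\<close>

lemma exp_scale_small_large:
  fixes a b e M :: real
  assumes "a > 0" "b > 0" "e > 0"
  obtains N where "N > 0" "exp (- N * a) < e" "exp (N * b) > M"
proof (rule that)
  define P where "P = 1 / e + \<bar>M\<bar>"
  let ?N = "P / a + P / b"
  have pos: "P > 0" using assms by (simp add: add_pos_nonneg P_def)
  then show "?N > 0" using assms by (intro add_pos_pos) auto
  have "?N * a \<ge> 1 / e + \<bar>M\<bar>" "?N * b \<ge> 1 / e + \<bar>M\<bar>"
    using assms pos by (simp_all add: distrib_right flip: P_def)
  then have "exp (?N * a) > 1 / e" "exp (?N * b) > M"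
    using exp_ge_add_one_self[of "?N * a"] exp_ge_add_one_self[of "?N * b"] assms(3)
      divide_pos_pos[of 1 e] by linarith+
  then show "exp (?N * b) > M" "exp (- ?N * a) < e"
    using assms(3) by (simp_all only: exp_minus mult_minus_left)
      (simp add: inverse_eq_divide pos_divide_less_eq mult.commute)
qed

text \<open>A mean value inequality for functions that are only tested from above. If f rose by more
  than c from a to a + v, then f minus a function of slope greater than c along v would have a
  maximum inside a thin tube around the segment, against \<open>test\<close>. The domain S of the
  test functions is separate from U, so that the lemma serves both R^n and the space-time
  strip.\<close>

lemma decrease_along_line:
  fixes f :: "'b::euclidean_space \<Rightarrow> real"
  assumes "open U" "continuous_on U f" "v \<noteq> 0"
    and seg: "closed_segment a (a + v) \<subseteq> U"
    and test: "\<And>\<phi> G z. C1_grad_on S \<phi> G \<Longrightarrow> z \<in> U \<Longrightarrow>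
       \<exists>e>0. \<forall>y\<in>ball z e \<inter> S. f y - \<phi> y \<le> f z - \<phi> z \<Longrightarrow> v \<bullet> G z \<le> c"
  shows "f (a + v) \<le> f a + c"
proof (rule ccontr)
  assume neg: "\<not> f (a + v) \<le> f a + c"
  define \<kappa> where "\<kappa> = (f (a + v) - f a - c) / 2"
  have \<kappa>: "\<kappa> > 0" using neg by (simp add: \<kappa>_def)
  define l where "l = (\<lambda>z. (z - a) \<bullet> (v /\<^sub>R (norm v)\<^sup>2))"
  have nv: "(norm v)\<^sup>2 > 0" using \<open>v \<noteq> 0\<close> by simp
  have l_line: "l (a + s *\<^sub>R v) = s" for s
    using nv by (simp add: l_def power2_norm_eq_inner)
  have lv: "(v /\<^sub>R (norm v)\<^sup>2) \<bullet> v = 1" using nv by (simp add: power2_norm_eq_inner)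
  have l_cont: "continuous_on X l" for X unfolding l_def by (intro continuous_intros)
  have in_U: "a + s *\<^sub>R v \<in> U" if "0 \<le> s" "s \<le> 1" for s
    using seg that by (auto simp: closed_segment_def subset_iff algebra_simps)
  define g where "g = (\<lambda>s. f (a + s *\<^sub>R v) - (c + \<kappa>) * s)"
  have g_cont: "continuous_on {0..1} g"
    unfolding g_def by (intro continuous_intros continuous_on_compose2[OF assms(2)]) (auto intro: in_U)
  have g1: "g 1 = f a + \<kappa>"
    unfolding g_def \<kappa>_def by (simp add: field_simps)
  have "(g \<longlongrightarrow> g 1) (at 1 within {0..1})"
    using g_cont by (simp add: continuous_on_def)
  then have "\<forall>\<^sub>F s in at 1 within {0..1}. g s > f a + \<kappa> / 2"
    by (rule order_tendstoD) (use g1 \<kappa> in auto)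
  then obtain d where d: "d > 0" "\<And>s. s \<in> {0..1} \<Longrightarrow> s \<noteq> 1 \<Longrightarrow> dist s 1 < d \<Longrightarrow> g s > f a + \<kappa> / 2"
    unfolding eventually_at by blast
  \<comment> \<open>The point at parameter s2 is the competitor in the maximisation. It stops short
    of 1 so that a threshold s1 fits in between: the exponential is then negligible at s2 and huge
    at the far end of the tube.\<close>
  define s2 where "s2 = 1 - min (d/2) (1/2)"
  have s2: "0 < s2" "s2 < 1" "g s2 > f a + \<kappa> / 2"
    using d by (auto simp: s2_def dist_real_def min_def)
  define s1 where "s1 = (s2 + 1) / 2"
  have s1: "s2 < s1" "s1 < 1" using s2 by (auto simp: s1_def)
  obtain r1 where r1: "r1 > 0" "(\<Union>x\<in>closed_segment a (a + v). cball x r1) \<subseteq> U"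
    using compact_subset_open_imp_cball_epsilon_subset[OF compact_segment \<open>open U\<close> seg] by blast
  have "a \<in> U" using in_U[of 0] by simp
  then have "isCont f a" using assms(1,2) continuous_on_eq_continuous_at by blast
  then obtain r2 where r2: "r2 > 0" "\<And>z. dist z a < r2 \<Longrightarrow> dist (f z) (f a) < \<kappa> / 4"
    using \<kappa> unfolding continuous_at_eps_delta by (metis divide_pos_pos zero_less_numeral)
  define r where "r = min r1 (r2 / 2)"
  have r: "r > 0" "r \<le> r1" "r < r2" using r1 r2 by (auto simp: r_def)
  define w where "w = (\<lambda>z. z - a - l z *\<^sub>R v)"
  have w_cont: "continuous_on X w" for X unfolding w_def by (intro continuous_intros l_cont)
  \<comment> \<open>Pythagoras: w is the component orthogonal to v. This form of its square is a
    combination of the available C^1 functions and has derivative 0 along v.\<close>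
  have w_sq: "(norm (w z))\<^sup>2 = (norm (z - a))\<^sup>2 + (- (norm v)\<^sup>2) * (l z * l z)" for z
  proof -
    have "(norm (w z))\<^sup>2 = (z - a) \<bullet> (z - a) - 2 * l z * ((z - a) \<bullet> v) + (l z)\<^sup>2 * (v \<bullet> v)"
      unfolding w_def power2_norm_eq_inner by (simp add: inner_diff inner_commute power2_eq_square algebra_simps)
    moreover have "(z - a) \<bullet> v = l z * (norm v)\<^sup>2"
      using nv by (simp add: l_def)
    ultimately show ?thesis
      unfolding power2_norm_eq_inner[symmetric] by (simp add: power2_eq_square algebra_simps)
  qed
  define K where "K = {z. 0 \<le> l z \<and> l z \<le> 1 \<and> norm (w z) \<le> r}"
  have K_U: "K \<subseteq> U"
  proof
    fix z assume z: "z \<in> K"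
    have "a + l z *\<^sub>R v \<in> closed_segment a (a + v)"
      using z by (auto simp: K_def closed_segment_def algebra_simps intro!: exI[of _ "l z"])
    moreover have "z \<in> cball (a + l z *\<^sub>R v) r1"
      using z r by (auto simp: K_def w_def dist_norm norm_minus_commute algebra_simps)
    ultimately show "z \<in> U" using r1 by blast
  qed
  have "closed K"
    unfolding K_def by (intro closed_Collect_conj closed_Collect_le continuous_intros l_cont w_cont)
  moreover have "bounded K"
  proof (rule boundedI)
    fix z assume z: "z \<in> K"
    have "z = a + l z *\<^sub>R v + w z" by (simp add: w_def)
    then have "norm z \<le> norm a + norm (l z *\<^sub>R v) + norm (w z)"
      by (metis norm_triangle_le add_mono_thms_linordered_semiring(3) norm_triangle_ineq)
    moreover have "norm (l z *\<^sub>R v) \<le> norm v"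
      using z by (auto simp: K_def intro: mult_left_le_one_le)
    ultimately show "norm z \<le> norm a + norm v + r" using z by (auto simp: K_def)
  qed
  ultimately have K: "compact K" by (simp add: compact_eq_bounded_closed)
  have f_K: "continuous_on K f" using assms(2) K_U continuous_on_subset by blast
  have "compact ((\<lambda>z. f z - (c + \<kappa>) * l z) ` K)"
    by (intro compact_continuous_image continuous_intros f_K l_cont K)
  then obtain M where M: "\<And>z. z \<in> K \<Longrightarrow> \<bar>f z - (c + \<kappa>) * l z\<bar> \<le> M"
    using bounded_iff[THEN iffD1, OF compact_imp_bounded] by fastforce
  obtain N where N: "N > 0" "exp (- N * (s1 - s2)) < \<kappa> / 4" "exp (N * (1 - s1)) > 2 * M + \<kappa>"
    using exp_scale_small_large[of "s1 - s2" "1 - s1" "\<kappa> / 4"] s1 \<kappa> by auto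
  \<comment> \<open>On the lateral boundary |w| = r the penalty equals 2 M + \<kappa>, which pushes
    the value down to at most - M - \<kappa>, whereas the maximum is larger.\<close>
  define n where "n = (2 * M + \<kappa>) / r\<^sup>2"
  have z2K: "a + s2 *\<^sub>R v \<in> K" using s2 r by (auto simp: K_def w_def l_line)
  then have M0: "M \<ge> 0" using M by force
  \<comment> \<open>The last term keeps the maximum near the line but is constant in direction \<open>v\<close>; the
    exponential is increasing in direction \<open>v\<close> and keeps the maximum away from the far end.\<close>
  define \<phi> where "\<phi> = (\<lambda>z. (c + \<kappa>) * l z + exp (N * l z + (- N * s1)) + n * ((norm (z - a))\<^sup>2 + (- (norm v)\<^sup>2) * (l z * l z)))"
  have l_C1: "C1_grad_on S l (\<lambda>z. v /\<^sub>R (norm v)\<^sup>2)" unfolding l_def by (rule C1_grad_on_inner)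
  obtain G where G: "C1_grad_on S \<phi> G" 
    "\<And>z. v \<bullet> G z = c + \<kappa> + N * exp (N * l z + (- N * s1))"
  proof -
    note D = C1_grad_on_add[OF C1_grad_on_add[OF C1_grad_on_cmult[OF l_C1, of "c + \<kappa>"] 
          C1_grad_on_exp[OF C1_grad_on_add[OF C1_grad_on_cmult[OF l_C1, of N] C1_grad_on_const[of _ "- N * s1"]]]]
        C1_grad_on_cmult[OF C1_grad_on_add[OF C1_grad_on_norm_sq[of _ a] 
          C1_grad_on_cmult[OF C1_grad_on_mult[OF l_C1 l_C1], of "- (norm v)\<^sup>2"]], of n]]
    show thesis
    proof (rule that)
      show "C1_grad_on S \<phi> (\<lambda>z. (c + \<kappa>) *\<^sub>R (v /\<^sub>R (norm v)\<^sup>2) + exp (N * l z + - N * s1) *\<^sub>R (N *\<^sub>R (v /\<^sub>R (norm v)\<^sup>2) + 0) +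
          n *\<^sub>R (2 *\<^sub>R (z - a) + (- (norm v)\<^sup>2) *\<^sub>R (l z *\<^sub>R (v /\<^sub>R (norm v)\<^sup>2) + l z *\<^sub>R (v /\<^sub>R (norm v)\<^sup>2))))"
        unfolding \<phi>_def by (rule D)
      fix z
      have "(z - a) \<bullet> v = l z * (norm v)\<^sup>2"
        using nv by (simp add: l_def)
      moreover have "v \<bullet> (v /\<^sub>R (norm v)\<^sup>2) = 1" using lv by (simp add: inner_commute)
      ultimately show "v \<bullet> ((c + \<kappa>) *\<^sub>R (v /\<^sub>R (norm v)\<^sup>2) + exp (N * l z + - N * s1) *\<^sub>R (N *\<^sub>R (v /\<^sub>R (norm v)\<^sup>2) + 0) +
          n *\<^sub>R (2 *\<^sub>R (z - a) + (- (norm v)\<^sup>2) *\<^sub>R (l z *\<^sub>R (v /\<^sub>R (norm v)\<^sup>2) + l z *\<^sub>R (v /\<^sub>R (norm v)\<^sup>2))))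
         = c + \<kappa> + N * exp (N * l z + (- N * s1))"
        unfolding inner_add_right inner_scaleR_right[of v] by (simp add: inner_commute)
    qed
  qed
  have \<phi>_alt: "\<phi> z = (c + \<kappa>) * l z + exp (N * (l z - s1)) + n * (norm (w z))\<^sup>2" for z
    unfolding \<phi>_def w_sq by (simp add: algebra_simps)
  have "continuous_on K (\<lambda>z. f z - \<phi> z)"
    unfolding \<phi>_alt by (intro continuous_intros f_K l_cont w_cont)
  then obtain z where z: "z \<in> K" "\<And>y. y \<in> K \<Longrightarrow> f y - \<phi> y \<le> f z - \<phi> z"
    using continuous_attains_sup[OF K] z2K by blast
  have "f (a + s2 *\<^sub>R v) - \<phi> (a + s2 *\<^sub>R v) = g s2 - exp (- N * (s1 - s2))"
    unfolding \<phi>_alt g_def w_def l_line by (simp add: algebra_simps)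
  then have val: "f z - \<phi> z > g s2 - \<kappa> / 4" using z(2)[OF z2K] N by linarith
  have "g s2 \<ge> - M" using M[OF z2K] unfolding g_def l_line by linarith
  then have val': "f z - \<phi> z > - M - \<kappa>" using val \<kappa> by linarith
  have n0: "n \<ge> 0" unfolding n_def using M0 \<kappa> by simp
  have "l z \<noteq> 1"
  proof
    assume "l z = 1"
    then have "f z - \<phi> z \<le> M - exp (N * (1 - s1))"
      using M[OF z(1)] n0 by (simp add: \<phi>_alt abs_le_iff) (smt (verit) mult_nonneg_nonneg zero_le_power2)
    then show False using N val' by linarith
  qed
  moreover have "norm (w z) \<noteq> r"
  proof
    assume "norm (w z) = r"
    then have "n * (norm (w z))\<^sup>2 = 2 * M + \<kappa>" using r by (simp add: n_def)
    then have "f z - \<phi> z \<le> M - (2 * M + \<kappa>)"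
      using M[OF z(1)] exp_ge_zero[of "N * (l z - s1)"] unfolding \<phi>_alt by linarith
    then show False using val' by linarith
  qed
  moreover have "l z \<noteq> 0"
  proof
    assume l0: "l z = 0"
    then have "w z = z - a" by (simp add: w_def)
    then have "dist z a < r2" using z(1) r by (auto simp: K_def dist_norm)
    then have "f z < f a + \<kappa> / 4"
      using r2(2)[OF \<open>dist z a < r2\<close>] unfolding dist_real_def by linarith
    moreover have "\<phi> z \<ge> 0" using l0 n0 unfolding \<phi>_alt by simp
    ultimately show False using val s2 by linarith
  qed
  ultimately have zint: "0 < l z" "l z < 1" "norm (w z) < r" using z(1) by (auto simp: K_def)
  have "open {z. 0 < l z \<and> l z < 1 \<and> norm (w z) < r}"
    by (intro open_Collect_conj open_Collect_less continuous_intros l_cont w_cont)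
  then obtain e where e: "e > 0" "ball z e \<subseteq> {z. 0 < l z \<and> l z < 1 \<and> norm (w z) < r}"
    using openE[of "{z. 0 < l z \<and> l z < 1 \<and> norm (w z) < r}" z] zint by blast
  then have "ball z e \<subseteq> K" by (auto simp: K_def)
  then have "\<exists>e>0. \<forall>y\<in>ball z e \<inter> S. f y - \<phi> y \<le> f z - \<phi> z" using e z(2) by blast
  from test[OF G(1) _ this] have "v \<bullet> G z \<le> c" using z(1) K_U by blast
  moreover have "N * exp (N * l z + (- N * s1)) > 0" using N by simp
  ultimately show False using G(2)[of z] \<kappa> by linarith
qed

lemma gradient_directional_le:
  fixes \<phi> :: "'b::euclidean_space \<Rightarrow> real"
  assumes "(\<phi> has_derivative (\<lambda>h. g \<bullet> h)) (at z)"
    and "\<forall>\<^sub>F h in at_right 0. \<phi> (z + h *\<^sub>R v) - \<phi> z \<le> c * h"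
  shows "g \<bullet> v \<le> c"
proof -
  have "((\<lambda>h. \<phi> (z + h *\<^sub>R v)) has_derivative (\<lambda>h. g \<bullet> (h *\<^sub>R v))) (at 0)"
    by (rule has_derivative_compose[where f = "\<lambda>h. z + h *\<^sub>R v" and g = \<phi>])
      (auto intro!: derivative_eq_intros simp: assms(1))
  then have "((\<lambda>h. \<phi> (z + h *\<^sub>R v)) has_real_derivative (g \<bullet> v)) (at 0)"
    by (simp add: has_field_derivative_def mult_commute_abs)
  then have "((\<lambda>h. \<phi> (z + h *\<^sub>R v)) has_real_derivative (g \<bullet> v)) (at_right 0)"
    by (rule has_field_derivative_at_within)
  then have "((\<lambda>h. (\<phi> (z + h *\<^sub>R v) - \<phi> z) / h) \<longlongrightarrow> g \<bullet> v) (at_right 0)"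
    by (simp add: has_field_derivative_iff)
  moreover have "\<forall>\<^sub>F h in at_right 0. (\<phi> (z + h *\<^sub>R v) - \<phi> z) / h \<le> c"
    using assms(2) eventually_at_right_less[of 0]
    by eventually_elim (simp add: pos_divide_le_eq)
  ultimately show ?thesis
    by (intro tendsto_upperbound) auto
qed

lemma eventually_at_right_in_ball:
  fixes z v :: "'b::real_normed_vector"
  assumes "e > 0"
  shows "\<forall>\<^sub>F h in at_right 0. z + h *\<^sub>R v \<in> ball z e"
proof -
  have "((\<lambda>h. z + h *\<^sub>R v) \<longlongrightarrow> z + 0 *\<^sub>R v) (at_right 0)"
    by (intro tendsto_intros)
  then show ?thesis
    using topological_tendstoD[OF _ open_ball, of "\<lambda>h. z + h *\<^sub>R v" "z + 0 *\<^sub>R v"] assms by simp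
qed

lemma subdiff_lipschitz_norm_le:
  fixes f :: "'b::euclidean_space \<Rightarrow> real"
  assumes "\<And>x y. \<bar>f x - f y\<bar> \<le> L * dist x y" "q \<in> subdiff f y"
  shows "norm q \<le> L"
proof -
  obtain \<phi> G e where *: "C1_grad_on UNIV \<phi> G" "G y = q" "e > 0"
    "\<And>z. z \<in> ball y e \<Longrightarrow> f z - \<phi> z \<ge> f y - \<phi> y"
    using assms(2) unfolding subdiff_on_def by auto
  have "\<forall>\<^sub>F h in at_right 0. \<phi> (y + h *\<^sub>R q) - \<phi> y \<le> (L * norm q) * h"
    using eventually_at_right_in_ball[OF *(3), of y q] eventually_at_right_less[of 0]
  proof eventually_elim
    case (elim h)
    have "f (y + h *\<^sub>R q) - f y \<le> L * norm q * h"
      using assms(1)[of "y + h *\<^sub>R q" y] elim(2) by (simp add: dist_norm mult_ac)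
    then show ?case using *(4)[OF elim(1)] by linarith
  qed
  then have "q \<bullet> q \<le> L * norm q"
    using * by (intro gradient_directional_le[of \<phi> _ y]) (auto simp: C1_grad_on_def)
  then have "norm q * norm q \<le> L * norm q" by (simp flip: power2_norm_eq_inner power2_eq_square)
  moreover have "L \<ge> 0"
  proof -
    obtain b :: 'b where "b \<in> Basis" using nonempty_Basis by blast
    then have "L * dist (y + b) y = L" by (simp add: dist_norm)
    then show ?thesis using assms(1)[of "y + b" y] by linarith
  qed
  ultimately show ?thesis by (cases "norm q = 0") auto
qed

text \<open>Functions touching - f from above are the negatives of functions touching f from below,
  so \<open>decrease_along_line\<close> for - f sees subgradients of f only. Convexity of the ball
  keeps the segment from z to y inside.\<close>

lemma subdiff_norm_le_imp_lipschitz: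
  fixes f :: "'b::euclidean_space \<Rightarrow> real"
  assumes "continuous_on UNIV f"
    and sub: "\<And>y q. y \<in> ball x0 R \<Longrightarrow> q \<in> subdiff f y \<Longrightarrow> norm q \<le> S"
    and yz: "y \<in> ball x0 R" "z \<in> ball x0 R"
  shows "f z \<le> f y + S * norm (z - y)"
proof (cases "z = y")
  case False
  have "(\<lambda>z. - f z) (z + (y - z)) \<le> (\<lambda>z. - f z) z + S * norm (z - y)"
  proof (rule decrease_along_line[where U = "ball x0 R" and S = UNIV])
    show "continuous_on (ball x0 R) (\<lambda>z. - f z)"
      using assms(1) by (intro continuous_intros) (rule continuous_on_subset, auto)
    show "closed_segment z (z + (y - z)) \<subseteq> ball x0 R"
      using yz convex_ball by (simp add: closed_segment_subset)
  next
    fix \<phi> G w assume C: "C1_grad_on UNIV \<phi> G" and w: "w \<in> ball x0 R"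
      and "\<exists>e>0. \<forall>y\<in>ball w e \<inter> UNIV. - f y - \<phi> y \<le> - f w - \<phi> w"
    then obtain e where e: "e > 0" "\<And>y. y \<in> ball w e \<Longrightarrow> - f y - \<phi> y \<le> - f w - \<phi> w" by auto
    then have "- G w \<in> subdiff f w"
      unfolding subdiff_on_def using C1_grad_on_uminus[OF C] by fastforce
    then have "norm (G w) \<le> S" using sub[OF w] by fastforce
    then have "norm (y - z) * norm (G w) \<le> norm (y - z) * S" by (rule mult_left_mono) simp
    then show "(y - z) \<bullet> G w \<le> S * norm (z - y)"
      using norm_cauchy_schwarz[of "y - z" "G w"] by (simp add: norm_minus_commute mult.commute)
  qed (use False in auto)
  then show ?thesis by simp
qed simp

text \<open>Minimise f + J |z - y| over the closed ball with I' < J < I. An interior minimum would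
  yield a subgradient of norm at most J, so the minimum lies on the sphere, and comparison with the
  centre gives the descent. The gap between I' and I pays for smoothing the distance at y.\<close>

lemma subdiff_norm_ge_imp_descent:
  fixes f :: "'b::euclidean_space \<Rightarrow> real"
  assumes "continuous_on UNIV f" "r > 0" "I' < I"
    and sub: "\<And>z q. z \<in> ball y r \<Longrightarrow> q \<in> subdiff f z \<Longrightarrow> norm q \<ge> I"
  obtains z where "z \<in> cball y r" "f z \<le> f y - I' * r"
proof (cases "I' \<le> 0")
  case True
  then have "I' * r \<le> 0" using assms(2) by (simp add: mult_nonpos_nonneg)
  then show ?thesis using that[of y] assms(2) by simp
next
  case False
  define J where "J = (I + I') / 2"
  have J: "0 < J" "I' < J" "J < I" using False assms(3) by (auto simp: J_def)
  \<comment> \<open>Smoothing raises the value at the centre by J \<epsilon>; this choice makes J r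
    - J \<epsilon> equal to I' r.\<close>
  define \<epsilon> where "\<epsilon> = r * (J - I') / J"
  have \<epsilon>: "\<epsilon> > 0" using J assms(2) by (simp add: \<epsilon>_def)
  define \<phi> where "\<phi> = (\<lambda>z. (- J) * sqrt ((norm (z - y))\<^sup>2 + \<epsilon>\<^sup>2))"
  have pos: "(norm (z - y))\<^sup>2 + \<epsilon>\<^sup>2 > 0" for z using \<epsilon> by (simp add: add_nonneg_pos)
  define G where "G = (\<lambda>z. (- J) *\<^sub>R ((inverse (sqrt ((norm (z - y))\<^sup>2 + \<epsilon>\<^sup>2)) / 2) *\<^sub>R (2 *\<^sub>R (z - y) + 0)))"
  have C: "C1_grad_on UNIV \<phi> G"
    unfolding \<phi>_def G_def
    by (intro C1_grad_on_cmult C1_grad_on_sqrt C1_grad_on_add C1_grad_on_norm_sq C1_grad_on_const pos)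
  have "continuous_on (cball y r) (\<lambda>z. f z - \<phi> z)"
    using assms(1) C1_grad_on_imp_continuous_on[OF C] by (intro continuous_intros) (auto elim: continuous_on_subset)
  then obtain z where z: "z \<in> cball y r" "\<And>w. w \<in> cball y r \<Longrightarrow> f z - \<phi> z \<le> f w - \<phi> w"
    using continuous_attains_inf[OF compact_cball, of y r "\<lambda>z. f z - \<phi> z"] assms(2) by auto
  have "z \<notin> ball y r"
  proof
    assume zb: "z \<in> ball y r"
    then obtain e where e: "e > 0" "ball z e \<subseteq> ball y r" by (meson open_ball openE)
    then have "\<exists>e>0. \<forall>w\<in>ball z e \<inter> UNIV. f w - \<phi> w \<ge> f z - \<phi> z"
      using z(2) by (intro exI[of _ e]) (auto simp: subset_iff)
    then have "G z \<in> subdiff f z" unfolding subdiff_on_def using C by blast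
    then have "I \<le> norm (G z)" using sub zb by blast
    moreover have "norm (G z) \<le> J"
    proof -
      have "norm (z - y) \<le> sqrt ((norm (z - y))\<^sup>2 + \<epsilon>\<^sup>2)" by (rule real_le_rsqrt) simp
      then have "norm (z - y) / sqrt ((norm (z - y))\<^sup>2 + \<epsilon>\<^sup>2) \<le> 1"
        using pos[of z] by (simp add: divide_le_eq_1)
      then have "J * (norm (z - y) / sqrt ((norm (z - y))\<^sup>2 + \<epsilon>\<^sup>2)) \<le> J * 1"
        using J by (intro mult_left_mono) auto
      moreover have "norm (G z) = J * (norm (z - y) / sqrt ((norm (z - y))\<^sup>2 + \<epsilon>\<^sup>2))"
      proof -
        define s where "s = sqrt ((norm (z - y))\<^sup>2 + \<epsilon>\<^sup>2)"
        have "s > 0" using pos[of z] by (simp add: s_def)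
        then show ?thesis using J unfolding G_def s_def[symmetric] add_0_right norm_scaleR
          by (simp add: inverse_eq_divide)
      qed
      ultimately show ?thesis by simp
    qed
    ultimately show False using J by simp
  qed
  then have "norm (z - y) = r" using z(1) by (auto simp: dist_norm norm_minus_commute)
  then have "- \<phi> z \<ge> J * r"
    unfolding \<phi>_def using J by (auto intro!: mult_left_mono real_le_rsqrt)
  moreover have "- \<phi> y = J * \<epsilon>" using \<epsilon> by (simp add: \<phi>_def)
  moreover have "J * \<epsilon> = J * r - I' * r" using J by (simp add: \<epsilon>_def field_simps)
  ultimately have "f z \<le> f y - I' * r" using z(2)[of y] assms(2) by simp
  then show ?thesis using that z(1) by blast
qed

section \<open>One-sided limits of suprema and infima of subgradient norms\<close>

lemma monotone_at_right_tendsto: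
  fixes g :: "real \<Rightarrow> real"
  assumes mono: "\<And>a b. 0 < a \<Longrightarrow> a \<le> b \<Longrightarrow> g a \<le> g b" and lb: "\<And>a. 0 < a \<Longrightarrow> m \<le> g a"
  obtains l where "(g \<longlongrightarrow> l) (at_right 0)"
proof -
  have bdd: "bdd_below (g ` {0<..})" using lb by (auto intro!: bdd_belowI2)
  have "(g \<longlongrightarrow> Inf (g ` {0<..})) (at_right 0)"
  proof (rule order_tendstoI)
    fix a assume a: "a < Inf (g ` {0<..})"
    show "\<forall>\<^sub>F x in at_right 0. a < g x"
      using eventually_at_right_less[of 0]
      by eventually_elim (rule less_le_trans[OF a], rule cInf_lower[OF _ bdd], auto)
  next
    fix a assume "Inf (g ` {0<..}) < a"
    then obtain d where d: "d > 0" "g d < a"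
      using cInf_lessD[of "g ` {0<..}" a] by auto
    then have "\<forall>\<^sub>F x in at_right 0. 0 < x \<and> x < d"
      using eventually_at_right_real[of 0 d] by simp
    then show "\<forall>\<^sub>F x in at_right 0. g x < a"
    proof eventually_elim
      case (elim x)
      then show ?case using mono[of x d] d by linarith
    qed
  qed
  then show thesis by (rule that)
qed

text \<open>\<open>Lim\<close>, \<open>Sup\<close> and \<open>Inf\<close> carry information only if
  the limit exists and the sets are nonempty and bounded. This is settled here once; afterwards only
  estimates on a slightly larger ball are used, at the price of e.\<close>

lemma Sbar_Ibar_approx:
  fixes u0 :: "'a::euclidean_space \<Rightarrow> real"
  assumes lip: "\<And>x y. \<bar>u0 x - u0 y\<bar> \<le> L * dist x y" and "e > 0" and R0: "Rfun A2 B2 x t \<ge> 0"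
  shows "\<exists>\<delta>>0. \<forall>y\<in>cball x (Rfun A2 B2 x t + \<delta>). \<forall>q\<in>subdiff u0 y. norm q \<le> Sbar A2 B2 u0 x t + e"
    and "\<exists>\<delta>>0. \<forall>y\<in>cball x (Rfun A2 B2 x t + \<delta>). \<forall>q\<in>subdiff u0 y. norm q \<ge> Ibar A2 B2 u0 x t - e"
    and "Sbar A2 B2 u0 x t \<ge> 0"
proof -
  define A where "A = (\<lambda>\<delta>. {norm p | p y. p \<in> subdiff u0 y \<and> y \<in> cball x (Rfun A2 B2 x t + \<delta>)})"
  have cont: "continuous_on UNIV u0"
  proof -
    have "\<bar>L\<bar>-lipschitz_on UNIV u0"
      by (rule lipschitz_onI) (use lip in \<open>auto simp: dist_real_def intro: order_trans[OF lip mult_right_mono]\<close>)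
    then show ?thesis by (rule lipschitz_on_continuous_on)
  qed
  have mono: "A a \<subseteq> A b" if "a \<le> b" for a b
    using that unfolding A_def by fastforce
  have AL: "0 \<le> s \<and> s \<le> L" if "s \<in> A \<delta>" for s \<delta>
    using that subdiff_lipschitz_norm_le[OF lip] unfolding A_def by auto
  have ne: "A \<delta> \<noteq> {}" if "\<delta> > 0" for \<delta>
  proof
    \<comment> \<open>Without subgradients in the ball the hypothesis of the descent lemma holds
      vacuously for any rate, and a rate above |L| contradicts the Lipschitz bound.\<close>
    assume emp: "A \<delta> = {}"
    have "\<exists>z. z \<in> cball x \<delta> \<and> u0 z \<le> u0 x - (\<bar>L\<bar> + 1) * \<delta>"
    proof (rule subdiff_norm_ge_imp_descent[OF cont \<open>\<delta> > 0\<close>, of "\<bar>L\<bar> + 1" "\<bar>L\<bar> + 2" x])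
      fix z q assume "z \<in> ball x \<delta>" "q \<in> subdiff u0 z"
      then have "norm q \<in> A \<delta>" unfolding A_def using R0 by fastforce
      then show "\<bar>L\<bar> + 2 \<le> norm q" using emp by simp
    qed auto
    then obtain z where z: "z \<in> cball x \<delta>" "u0 z \<le> u0 x - (\<bar>L\<bar> + 1) * \<delta>" by blast
    have "L * dist x z \<le> \<bar>L\<bar> * \<delta>" using z(1) by (intro mult_mono) auto
    then show False using lip[of x z] z(2) that by (simp add: algebra_simps)
  qed
  have bA: "bdd_above (A \<delta>)" "bdd_below (A \<delta>)" for \<delta>
    using AL by (auto intro!: bdd_aboveI[of _ L] bdd_belowI[of _ 0])
  have Sup0: "0 \<le> Sup (A a)" if "0 < a" for a
    using ne[OF that] AL bA by (meson cSup_upper2 ex_in_conv)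
  obtain l where l: "((\<lambda>\<delta>. Sup (A \<delta>)) \<longlongrightarrow> l) (at_right 0)"
  proof (rule monotone_at_right_tendsto)
    show "Sup (A a) \<le> Sup (A b)" if "0 < a" "a \<le> b" for a b
      using that by (intro cSup_subset_mono ne bA mono) auto
    show "0 \<le> Sup (A a)" if "0 < a" for a using that by (rule Sup0)
  qed
  have S: "Sbar A2 B2 u0 x t = l"
    unfolding Sbar_def using l by (intro tendsto_Lim) (auto simp: A_def)
  have "\<forall>\<^sub>F \<delta> in at_right 0. 0 \<le> Sup (A \<delta>)"
    using eventually_at_right_less[of 0] by eventually_elim (rule Sup0)
  then show "Sbar A2 B2 u0 x t \<ge> 0"
    unfolding S by (rule tendsto_lowerbound[OF l]) simp
  obtain k where "((\<lambda>\<delta>. - Inf (A \<delta>)) \<longlongrightarrow> k) (at_right 0)"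
  proof (rule monotone_at_right_tendsto)
    show "- Inf (A a) \<le> - Inf (A b)" if "0 < a" "a \<le> b" for a b
      using that by (simp, intro cInf_superset_mono ne bA mono) auto
    show "- L \<le> - Inf (A a)" if "0 < a" for a
      using ne[OF that] AL bA by (simp, meson cInf_lower2 ex_in_conv)
  qed
  then have k: "((\<lambda>\<delta>. Inf (A \<delta>)) \<longlongrightarrow> - k) (at_right 0)"
    using tendsto_minus by fastforce
  have I: "Ibar A2 B2 u0 x t = - k"
    unfolding Ibar_def using k by (intro tendsto_Lim) (auto simp: A_def)
  have "\<forall>\<^sub>F \<delta> in at_right 0. Sup (A \<delta>) < l + e"
    using l \<open>e > 0\<close> by (intro order_tendstoD) auto
  then have "\<forall>\<^sub>F \<delta> in at_right 0. \<delta> > 0 \<and> Sup (A \<delta>) < l + e"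
    using eventually_at_right_less[of 0] by eventually_elim simp
  then obtain \<delta> where d: "\<delta> > 0" "Sup (A \<delta>) < l + e"
    using eventually_happens'[OF trivial_limit_at_right_real] by blast
  have "norm q \<le> l + e" if "y \<in> cball x (Rfun A2 B2 x t + \<delta>)" "q \<in> subdiff u0 y" for y q
  proof -
    have "norm q \<in> A \<delta>" using that unfolding A_def by blast
    then have "norm q \<le> Sup (A \<delta>)" using bA by (intro cSup_upper)
    then show ?thesis using d by simp
  qed
  then show "\<exists>\<delta>>0. \<forall>y\<in>cball x (Rfun A2 B2 x t + \<delta>). \<forall>q\<in>subdiff u0 y. norm q \<le> Sbar A2 B2 u0 x t + e"
    unfolding S using d(1) by blast
  have "\<forall>\<^sub>F \<delta> in at_right 0. Inf (A \<delta>) > - k - e"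
    using k \<open>e > 0\<close> by (intro order_tendstoD) auto
  then have "\<forall>\<^sub>F \<delta> in at_right 0. \<delta> > 0 \<and> Inf (A \<delta>) > - k - e"
    using eventually_at_right_less[of 0] by eventually_elim simp
  then obtain \<delta>' where d': "\<delta>' > 0" "Inf (A \<delta>') > - k - e"
    using eventually_happens'[OF trivial_limit_at_right_real] by blast
  have "norm q \<ge> - k - e" if "y \<in> cball x (Rfun A2 B2 x t + \<delta>')" "q \<in> subdiff u0 y" for y q
  proof -
    have "norm q \<in> A \<delta>'" using that unfolding A_def by blast
    then have "norm q \<ge> Inf (A \<delta>')" using bA by (intro cInf_lower)
    then show ?thesis using d' by simp
  qed
  then show "\<exists>\<delta>>0. \<forall>y\<in>cball x (Rfun A2 B2 x t + \<delta>). \<forall>q\<in>subdiff u0 y. norm q \<ge> Ibar A2 B2 u0 x t - e"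
    unfolding I using d'(1) by blast
qed

section \<open>Comparison in the domain of dependence\<close>

text \<open>With \<open>\<sigma> = 1\<close> this is the subsolution property; the supersolution property of \<open>u\<close> is the
  case \<open>V = - u\<close>, \<open>F x t r p = - H x t (- r) (- p)\<close>; and \<open>\<sigma> = - 1\<close>, \<open>V = - u\<close>,
  \<open>F x t r p = H x t (- r) (- p)\<close> says that \<open>u\<close> is a subsolution in the sense of Barron and Jensen,
  i.e. tested from below.\<close>

definition visc_ineq :: "real \<Rightarrow> real \<Rightarrow> real \<Rightarrow>
    ('a::euclidean_space \<Rightarrow> real \<Rightarrow> real \<Rightarrow> 'a \<Rightarrow> real) \<Rightarrow> ('a \<times> real \<Rightarrow> real) \<Rightarrow> bool" where
  "visc_ineq T T' \<sigma> F V \<longleftrightarrow>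
     (\<forall>\<phi> G x t. C1_grad_on (UNIV \<times> {0<..<T}) \<phi> G \<and> 0 < t \<and> t < T' \<and>
        (\<exists>e>0. \<forall>z\<in>ball (x,t) e \<inter> (UNIV \<times> {0<..<T}). V z - \<phi> z \<le> V (x,t) - \<phi> (x,t))
        \<longrightarrow> \<sigma> * snd (G (x,t)) + F x t (V (x,t)) (fst (G (x,t))) \<le> 0)"

lemma visc_ineqD:
  assumes "visc_ineq T T' \<sigma> F V" "C1_grad_on (UNIV \<times> {0<..<T}) \<phi> G" "0 < t" "t < T'" "e > 0"
    and "\<And>z. z \<in> ball (x,t) e \<Longrightarrow> 0 < snd z \<Longrightarrow> snd z < T \<Longrightarrow> V z - \<phi> z \<le> V (x,t) - \<phi> (x,t)"
  shows "\<sigma> * snd (G (x,t)) + F x t (V (x,t)) (fst (G (x,t))) \<le> 0"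
proof -
  have "\<exists>e>0. \<forall>z\<in>ball (x,t) e \<inter> (UNIV \<times> {0<..<T}). V z - \<phi> z \<le> V (x,t) - \<phi> (x,t)"
    using assms(5,6) by force
  then show ?thesis using assms(1-4) unfolding visc_ineq_def by blast
qed

text \<open>The second time bound limits only the contact points; test functions stay on the whole
  strip up to T. The freedom is needed in \<open>descent_propagation\<close>, where
  \<open>decay\<close> is known to be nonnegative only before some T'.\<close>

lemma visc_ineq_mono: "visc_ineq T T'' \<sigma> F V \<Longrightarrow> T' \<le> T'' \<Longrightarrow> visc_ineq T T' \<sigma> F V"
  unfolding visc_ineq_def by (meson less_le_trans)

locale hamiltonian =
  fixes H :: "'a::euclidean_space \<Rightarrow> real \<Rightarrow> real \<Rightarrow> 'a \<Rightarrow> real"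
    and T C1 \<beta> A2 B2 K3 :: real
  assumes T: "T > 0"
    and Hcont: "continuous_on (UNIV \<times> {0..T} \<times> UNIV \<times> UNIV) (\<lambda>(x,t,r,p). H x t r p)"
    and C1: "C1 \<ge> 0" and \<beta>: "\<beta> = 0 \<or> \<beta> = 1"
    and H1: "\<And>x y t r p. t \<in> {0..T} \<Longrightarrow> \<bar>H x t r p - H y t r p\<bar> \<le> C1 * (\<beta> + norm p) * dist x y"
    and A2: "A2 \<ge> 0" and B2: "B2 \<ge> 0"
    and H2: "\<And>x t r p q. t \<in> {0..T} \<Longrightarrow> \<bar>H x t r p - H x t r q\<bar> \<le> (A2 * norm x + B2) * dist p q"
    and K3: "K3 \<ge> 0"
    and H3: "\<And>x t r s p. t \<in> {0..T} \<Longrightarrow> \<bar>H x t r p - H x t s p\<bar> \<le> K3 * \<bar>r - s\<bar>"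
begin

definition neg_H :: "'a \<Rightarrow> real \<Rightarrow> real \<Rightarrow> 'a \<Rightarrow> real" where
  "neg_H x t r p = H x t (- r) (- p)"

text \<open>Doubling of variables: z and w maximise f z - g w - B z minus quadratic penalties in
  space and time. The contact pair (z0, z0) makes the maximum nonnegative, which bounds the
  penalties. Adding the two viscosity inequalities cancels the time penalty, and B, a function of z
  only, enters through the inequality for f alone. Both Hamiltonians end up at the time of z, as
  (H1) to (H3) require.\<close>

lemma doubling_maximizer:
  fixes f g B :: "'a \<times> real \<Rightarrow> real" and n :: real
  assumes fc: "continuous_on (UNIV \<times> {0..<T}) f" and gc: "continuous_on (UNIV \<times> {0..<T}) g"
    and Bc: "continuous_on (UNIV \<times> {0..<T}) B"
    and f: "visc_ineq T T' 1 H f" and g: "visc_ineq T T' 1 (\<lambda>x t r p. - neg_H x t r p) (\<lambda>z. - g z)"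
    and BG: "C1_grad_on (UNIV \<times> {0<..<T}) B G"
    and t1: "0 < t1" "t1 < T'" "T' \<le> T" and n: "n > 0"
    and M: "\<And>z. z \<in> cball x0 \<rho> \<times> {0..t1} \<Longrightarrow> \<bar>f z\<bar> \<le> M \<and> \<bar>g z\<bar> \<le> M \<and> \<bar>B z\<bar> \<le> M"
    and z0: "z0 \<in> cball x0 \<rho> \<times> {0..t1}" "f z0 - g z0 = B z0"
  shows "\<exists>z w. z \<in> cball x0 \<rho> \<times> {0..t1} \<and> w \<in> cball x0 \<rho> \<times> {0..t1} \<and>
    n * (norm (fst z - fst w))\<^sup>2 \<le> f z - g w - B z \<and> \<bar>snd z - snd w\<bar> \<le> 1 / n \<and>
    (z \<in> ball x0 \<rho> \<times> {0<..<t1} \<longrightarrow> w \<in> ball x0 \<rho> \<times> {0<..<t1} \<longrightarrow>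
      snd (G z) + H (fst z) (snd z) (f z) ((2 * n) *\<^sub>R (fst z - fst w) + fst (G z))
        - H (fst w) (snd z) (g w) ((2 * n) *\<^sub>R (fst z - fst w)) \<le> 1 / n)"
proof -
  define Q where "Q = cball x0 \<rho> \<times> {0..t1}"
  have Q: "compact Q" unfolding Q_def by (intro compact_Times compact_cball compact_Icc)
  have QT: "Q \<subseteq> UNIV \<times> {0..<T}" using t1 by (auto simp: Q_def)
  have M0: "M \<ge> 0" using M[OF z0(1)] by linarith
  \<comment> \<open>D contains the arguments at which H is shifted in time: the doubled gradient is
    p = 2 n (x - y) with |x - y| \<le> 2 \<rho>.\<close>
  define D where "D = cball x0 \<rho> \<times> {0..t1} \<times> {-M..M} \<times> cball (0::'a) (2 * n * (2 * \<rho>))"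
  have "compact D" unfolding D_def by (intro compact_Times compact_cball compact_Icc)
  moreover have "D \<subseteq> UNIV \<times> {0..T} \<times> UNIV \<times> UNIV" using t1 by (auto simp: D_def)
  ultimately have "uniformly_continuous_on D (\<lambda>(x,t,r,p). H x t r p)"
    using Hcont continuous_on_subset by (intro compact_uniformly_continuous) auto
  then obtain d where d: "d > 0" "\<And>a b. a \<in> D \<Longrightarrow> b \<in> D \<Longrightarrow> dist b a < d \<Longrightarrow>
      dist ((\<lambda>(x,t,r,p). H x t r p) b) ((\<lambda>(x,t,r,p). H x t r p) a) < 1 / n"
    using n unfolding uniformly_continuous_on_def by (metis divide_pos_pos zero_less_one)
  \<comment> \<open>\<open>H\<close> has no modulus of continuity in \<open>t\<close> that is uniform in \<open>p\<close>, so the penalty \<open>j\<close> in time is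
    chosen after the penalty \<open>n\<close> in space, which bounds \<open>p\<close>.\<close>
  define d' where "d' = min d (1 / n)"
  have d': "d' > 0" "d' \<le> d" "d' \<le> 1 / n" using d n by (auto simp: d'_def)
  define j where "j = (3 * M + 1) / d'\<^sup>2"
  have j: "j > 0" using M0 d' by (simp add: j_def)
  define \<Phi> where "\<Phi> = (\<lambda>(z,w). f z - g w - B z - n * (norm (fst z - fst w))\<^sup>2 - j * (snd z - snd w)\<^sup>2)"
  have "continuous_on (Q \<times> Q) \<Phi>"
    unfolding \<Phi>_def case_prod_beta
    by (intro continuous_intros continuous_on_compose2[OF fc] continuous_on_compose2[OF gc]
        continuous_on_compose2[OF Bc]) (use QT in auto)
  moreover have z0Q: "(z0,z0) \<in> Q \<times> Q" using z0 by (simp add: Q_def)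
  ultimately have "\<exists>zw\<in>Q \<times> Q. \<forall>v\<in>Q \<times> Q. \<Phi> v \<le> \<Phi> zw"
    by (intro continuous_attains_sup compact_Times Q) auto
  then obtain zw where zw: "zw \<in> Q \<times> Q" "\<And>v. v \<in> Q \<times> Q \<Longrightarrow> \<Phi> v \<le> \<Phi> zw" by blast
  obtain x t y s where zw_eq: "zw = ((x,t),(y,s))" by (metis prod.collapse)
  have z: "(x,t) \<in> Q" and w: "(y,s) \<in> Q" using zw zw_eq by auto
  have "\<Phi> (z0,z0) \<le> \<Phi> ((x,t),(y,s))" using zw(2)[OF z0Q] unfolding zw_eq .
  then have pos: "n * (norm (x - y))\<^sup>2 + j * (t - s)\<^sup>2 \<le> f (x,t) - g (y,s) - B (x,t)"
    using z0 by (simp add: \<Phi>_def)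
  have nn: "n * (norm (x - y))\<^sup>2 \<ge> 0" "j * (t - s)\<^sup>2 \<ge> 0" using n j by simp_all
  have "j * (t - s)\<^sup>2 \<le> 3 * M"
    using pos nn M[of "(x,t)"] M[of "(y,s)"] z w unfolding Q_def by linarith
  also have "\<dots> < j * d'\<^sup>2" using d' by (simp add: j_def)
  finally have "(t - s)\<^sup>2 < d'\<^sup>2" using j by simp
  then have ts: "\<bar>t - s\<bar> < d'" using d' by (intro power2_less_imp_less[of "\<bar>t - s\<bar>"]) auto
  define p where "p = (2 * n) *\<^sub>R (x - y)"
  have eq: "snd (G (x,t)) + H x t (f (x,t)) (p + fst (G (x,t))) - H y t (g (y,s)) p \<le> 1 / n"
    if zi: "(x,t) \<in> ball x0 \<rho> \<times> {0<..<t1}" and wi: "(y,s) \<in> ball x0 \<rho> \<times> {0<..<t1}"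
  proof -
    have op: "open (ball x0 \<rho> \<times> {0<..<t1})" by (intro open_Times) auto
    have sub: "ball x0 \<rho> \<times> {0<..<t1} \<subseteq> Q" by (auto simp: Q_def)
    obtain e1 where "e1 > 0" "ball (x,t) e1 \<subseteq> ball x0 \<rho> \<times> {0<..<t1}" by (rule openE[OF op zi])
    then have e1: "e1 > 0" "ball (x,t) e1 \<subseteq> Q" using sub by (simp_all only: order_trans)
    obtain e2 where "e2 > 0" "ball (y,s) e2 \<subseteq> ball x0 \<rho> \<times> {0<..<t1}" by (rule openE[OF op wi])
    then have e2: "e2 > 0" "ball (y,s) e2 \<subseteq> Q" using sub by (simp_all only: order_trans)
    have "1 * snd (n *\<^sub>R (2 *\<^sub>R (fst (x,t) - y), 0::real) + j *\<^sub>R (0, 2 * (snd (x,t) - s)) + G (x,t))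
        + H x t (f (x,t)) (fst (n *\<^sub>R (2 *\<^sub>R (fst (x,t) - y), 0::real) + j *\<^sub>R (0, 2 * (snd (x,t) - s)) + G (x,t))) \<le> 0"
    proof (rule visc_ineqD[OF f, where \<phi> = "\<lambda>z. n * (norm (fst z - y))\<^sup>2 + j * (snd z - s)\<^sup>2 + B z"])
      show "C1_grad_on (UNIV \<times> {0<..<T}) (\<lambda>z. n * (norm (fst z - y))\<^sup>2 + j * (snd z - s)\<^sup>2 + B z)
          (\<lambda>z. n *\<^sub>R (2 *\<^sub>R (fst z - y), 0) + j *\<^sub>R (0, 2 * (snd z - s)) + G z)"
        by (intro C1_grad_on_add C1_grad_on_cmult C1_grad_on_fst_norm_sq C1_grad_on_snd_sq BG)
      show "0 < t" "t < T'" using zi t1 by auto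
      show "e1 > 0" by fact
      fix z assume "z \<in> ball (x,t) e1"
      then have "(z,(y,s)) \<in> Q \<times> Q" using w e1 by auto
      then have "\<Phi> (z,(y,s)) \<le> \<Phi> ((x,t),(y,s))" using zw(2) unfolding zw_eq by blast
      then show "f z - (n * (norm (fst z - y))\<^sup>2 + j * (snd z - s)\<^sup>2 + B z) \<le>
         f (x,t) - (n * (norm (fst (x,t) - y))\<^sup>2 + j * (snd (x,t) - s)\<^sup>2 + B (x,t))"
        by (simp add: \<Phi>_def)
    qed
    then have f': "2 * j * (t - s) + snd (G (x,t)) + H x t (f (x,t)) (p + fst (G (x,t))) \<le> 0"
      by (simp add: p_def mult_ac)
    have "1 * snd (n *\<^sub>R (2 *\<^sub>R (fst (y,s) - x), 0::real) + j *\<^sub>R (0, 2 * (snd (y,s) - t)))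
        + - neg_H y s (- g (y,s)) (fst (n *\<^sub>R (2 *\<^sub>R (fst (y,s) - x), 0::real) + j *\<^sub>R (0, 2 * (snd (y,s) - t)))) \<le> 0"
    proof (rule visc_ineqD[OF g, where \<phi> = "\<lambda>z. n * (norm (fst z - x))\<^sup>2 + j * (snd z - t)\<^sup>2"])
      show "C1_grad_on (UNIV \<times> {0<..<T}) (\<lambda>z. n * (norm (fst z - x))\<^sup>2 + j * (snd z - t)\<^sup>2)
          (\<lambda>z. n *\<^sub>R (2 *\<^sub>R (fst z - x), 0) + j *\<^sub>R (0, 2 * (snd z - t)))"
        by (intro C1_grad_on_add C1_grad_on_cmult C1_grad_on_fst_norm_sq C1_grad_on_snd_sq)
      show "0 < s" "s < T'" using wi t1 by auto
      show "e2 > 0" by fact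
      fix w assume "w \<in> ball (y,s) e2"
      then have "((x,t),w) \<in> Q \<times> Q" using z e2 by auto
      then have "\<Phi> ((x,t),w) \<le> \<Phi> ((x,t),(y,s))" using zw(2) unfolding zw_eq by blast
      then show "- g w - (n * (norm (fst w - x))\<^sup>2 + j * (snd w - t)\<^sup>2) \<le>
         - g (y,s) - (n * (norm (fst (y,s) - x))\<^sup>2 + j * (snd (y,s) - t)\<^sup>2)"
        by (simp add: \<Phi>_def norm_minus_commute power2_commute)
    qed
    moreover have "- (n *\<^sub>R 2 *\<^sub>R (y - x)) = p" by (simp add: p_def algebra_simps)
    ultimately have g': "2 * j * (s - t) - H y s (g (y,s)) p \<le> 0"
      by (simp add: neg_H_def mult_ac)
    have "norm (x - y) \<le> 2 * \<rho>"
      using z w norm_triangle_ineq4[of "x - x0" "y - x0"] by (simp add: Q_def dist_norm norm_minus_commute)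
    then have "(2 * n) * norm (x - y) \<le> 2 * n * (2 * \<rho>)" using n by simp
    then have pD: "p \<in> cball 0 (2 * n * (2 * \<rho>))" using n by (simp add: p_def)
    have gM: "g (y,s) \<in> {-M..M}" using M[of "(y,s)"] w unfolding Q_def by auto
    have "(y,t,g (y,s),p) \<in> D" "(y,s,g (y,s),p) \<in> D"
      using z w pD gM by (auto simp: D_def Q_def)
    moreover have "dist (y,t,g (y,s),p) (y,s,g (y,s),p) < d"
      using ts d' by (simp add: dist_Pair_Pair dist_real_def)
    ultimately have "dist (H y t (g (y,s)) p) (H y s (g (y,s)) p) < 1 / n"
      using d(2)[of "(y,s,g (y,s),p)" "(y,t,g (y,s),p)"] by simp
    then have "H y s (g (y,s)) p \<le> H y t (g (y,s)) p + 1 / n" unfolding dist_real_def by linarith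
    then show ?thesis using f' g' by (simp add: algebra_simps)
  qed
  have "n * (norm (x - y))\<^sup>2 \<le> f (x,t) - g (y,s) - B (x,t)" "\<bar>t - s\<bar> \<le> 1 / n"
    using pos nn ts d' by linarith+
  then show ?thesis
    using z w eq unfolding Q_def p_def
    by (intro exI[of _ "(x,t)"] exI[of _ "(y,s)"]) (simp only: fst_conv snd_conv, simp)
qed

end

lemma LIMSEQ_squeeze_zero:
  fixes a b :: "nat \<Rightarrow> real"
  assumes "\<And>n. 0 \<le> a n" "\<And>n. a n \<le> b n" "b \<longlonglongrightarrow> 0"
  shows "a \<longlonglongrightarrow> 0"
  using assms by (intro tendsto_sandwich[OF _ _ tendsto_const[of 0] assms(3)]) simp_all

context hamiltonian
begin

text \<open>B grows faster than the difference of a sub- and a supersolution can: the gradient term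
  in \<open>growth\<close> cancels the error of (H2), and (K3 + 1) B beats the error K3 |f - g| of
  (H3). Letting n tend to infinity in \<open>doubling_maximizer\<close> leaves B \<le> 0 at a
  limiting contact point, against \<open>strict\<close>.\<close>

lemma no_touching_barrier:
  fixes f g B :: "'a \<times> real \<Rightarrow> real"
  assumes fc: "continuous_on (UNIV \<times> {0..<T}) f" and gc: "continuous_on (UNIV \<times> {0..<T}) g"
    and Bc: "continuous_on (UNIV \<times> {0..<T}) B"
    and f: "visc_ineq T T' 1 H f" and g: "visc_ineq T T' 1 (\<lambda>x t r p. - neg_H x t r p) (\<lambda>z. - g z)"
    and BG: "C1_grad_on (UNIV \<times> {0<..<T}) B G"
    and t1: "0 < t1" "t1 < T'" "T' \<le> T"
    and growth: "\<And>x t. x \<in> ball x0 \<rho> \<Longrightarrow> 0 < t \<Longrightarrow> t < t1 \<Longrightarrow>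
        snd (G (x,t)) \<ge> (K3 + 1) * B (x,t) + (A2 * norm x + B2) * norm (fst (G (x,t)))"
    and le: "\<And>z. z \<in> cball x0 \<rho> \<times> {0..t1} \<Longrightarrow> f z - g z \<le> B z"
    and strict: "\<And>z. z \<in> cball x0 \<rho> \<times> {0..t1} \<Longrightarrow> f z - g z = B z \<Longrightarrow>
        z \<in> ball x0 \<rho> \<times> {0<..<t1} \<and> B z > 0"
    and z0: "z0 \<in> cball x0 \<rho> \<times> {0..t1}"
  shows "f z0 - g z0 \<noteq> B z0"
proof
  assume touch: "f z0 - g z0 = B z0"
  define Q where "Q = cball x0 \<rho> \<times> {0..t1}"
  have Q: "compact Q" unfolding Q_def by (intro compact_Times compact_cball compact_Icc)
  have QT: "Q \<subseteq> UNIV \<times> {0..<T}" using t1 by (auto simp: Q_def)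
  have fQ: "continuous_on Q f" and gQ: "continuous_on Q g" and BQ: "continuous_on Q B"
    using fc gc Bc QT by (auto elim: continuous_on_subset)
  have bd: "\<exists>M. \<forall>z\<in>Q. \<bar>h z\<bar> \<le> M" if "continuous_on Q h" for h :: "'a \<times> real \<Rightarrow> real"
    using compact_imp_bounded[OF compact_continuous_image[OF that Q]] unfolding bounded_iff by auto
  obtain Mf Mg MB where M': "\<And>z. z \<in> Q \<Longrightarrow> \<bar>f z\<bar> \<le> Mf" "\<And>z. z \<in> Q \<Longrightarrow> \<bar>g z\<bar> \<le> Mg" "\<And>z. z \<in> Q \<Longrightarrow> \<bar>B z\<bar> \<le> MB"
    using bd[OF fQ] bd[OF gQ] bd[OF BQ] by metis
  define M where "M = max Mf (max Mg MB)"
  have M: "\<bar>f z\<bar> \<le> M \<and> \<bar>g z\<bar> \<le> M \<and> \<bar>B z\<bar> \<le> M" if "z \<in> Q" for z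
    using M'[OF that] by (auto simp: M_def)
  define N where "N = (\<lambda>n. real (Suc n))"
  have N: "N n > 0" for n by (simp add: N_def)
  define P where "P = (\<lambda>n z w. z \<in> Q \<and> w \<in> Q \<and>
    n * (norm (fst z - fst w))\<^sup>2 \<le> f z - g w - B z \<and> \<bar>snd z - snd w\<bar> \<le> 1 / n \<and>
    (z \<in> ball x0 \<rho> \<times> {0<..<t1} \<longrightarrow> w \<in> ball x0 \<rho> \<times> {0<..<t1} \<longrightarrow>
      snd (G z) + H (fst z) (snd z) (f z) ((2 * n) *\<^sub>R (fst z - fst w) + fst (G z))
        - H (fst w) (snd z) (g w) ((2 * n) *\<^sub>R (fst z - fst w)) \<le> 1 / n))"
  have "\<exists>z w. P (N n) z w" for n
    unfolding P_def Q_def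
    by (rule doubling_maximizer[OF fc gc Bc f g BG t1 N _ z0 touch]) (rule M, simp add: Q_def)
  then obtain z w where zw: "\<And>n. P (N n) (z n) (w n)" by metis
  have "seq_compact (Q \<times> Q)" using compact_Times[OF Q Q] by (simp add: compact_eq_seq_compact_metric)
  moreover have "(z n, w n) \<in> Q \<times> Q" for n using zw[of n] by (simp add: P_def)
  ultimately obtain l and r :: "nat \<Rightarrow> nat" where l: "l \<in> Q \<times> Q" and r: "strict_mono r"
    and lim: "((\<lambda>n. (z n, w n)) \<circ> r) \<longlonglongrightarrow> l"
    using seq_compactE[of "Q \<times> Q" "\<lambda>n. (z n, w n)"] by blast
  obtain a b where ab: "l = (a,b)" by (cases l)
  define Z W m where "Z = z \<circ> r" and "W = w \<circ> r" and "m = N \<circ> r"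
  have Zl: "Z \<longlonglongrightarrow> a" and Wl: "W \<longlonglongrightarrow> b"
    using tendsto_fst[OF lim] tendsto_snd[OF lim] by (simp_all add: ab Z_def W_def comp_def)
  have ZW: "P (m n) (Z n) (W n)" for n using zw[of "r n"] by (simp add: Z_def W_def m_def)
  have ZQ: "Z n \<in> Q" and WQ: "W n \<in> Q" for n using ZW[of n] by (auto simp: P_def)
  have aQ: "a \<in> Q" and bQ: "b \<in> Q" using l ab by auto
  have m: "m n > 0" for n by (simp add: m_def N)
  have inv_m: "(\<lambda>n. 1 / m n) \<longlonglongrightarrow> 0"
    using LIMSEQ_subseq_LIMSEQ[OF LIMSEQ_inverse_real_of_nat r]
    by (simp add: m_def N_def comp_def inverse_eq_divide)
  define \<Delta> where "\<Delta> = (\<lambda>n. f (Z n) - g (W n) - B (Z n))"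
  have \<Delta>l: "\<Delta> \<longlonglongrightarrow> f a - g b - B a"
    unfolding \<Delta>_def
    by (intro tendsto_diff continuous_on_tendsto_compose[OF fQ Zl aQ] continuous_on_tendsto_compose[OF gQ Wl bQ]
        continuous_on_tendsto_compose[OF BQ Zl aQ]) (simp_all add: ZQ WQ)
  have pen: "m n * (norm (fst (Z n) - fst (W n)))\<^sup>2 \<le> \<Delta> n" "\<bar>snd (Z n) - snd (W n)\<bar> \<le> 1 / m n" for n
    using ZW[of n] by (auto simp: P_def \<Delta>_def)
  have \<Delta>3: "\<Delta> n \<le> 3 * M" for n
    using M[OF ZQ[of n]] M[OF WQ[of n]] unfolding \<Delta>_def by linarith
  \<comment> \<open>A crude bound, used only to identify the limits of Z and W; that the penalty
    itself tends to 0 follows once both limits are known to be the same contact point.\<close>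
  have sq: "(norm (fst (Z n) - fst (W n)))\<^sup>2 \<le> (3 * M) * (1 / m n)" for n
    using pen(1)[of n] \<Delta>3[of n] m[of n] by (simp add: field_simps)
  have b0: "(\<lambda>n. (3 * M) * (1 / m n)) \<longlonglongrightarrow> 0" using tendsto_mult_left[OF inv_m, of "3 * M"] by simp
  have "(\<lambda>n. (norm (fst (Z n) - fst (W n)))\<^sup>2) \<longlonglongrightarrow> 0"
    by (rule LIMSEQ_squeeze_zero[OF _ sq b0]) simp
  moreover have "(\<lambda>n. (norm (fst (Z n) - fst (W n)))\<^sup>2) \<longlonglongrightarrow> (norm (fst a - fst b))\<^sup>2"
    by (intro tendsto_intros Zl Wl)
  ultimately have "(norm (fst a - fst b))\<^sup>2 = 0" by (rule LIMSEQ_unique[symmetric])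
  then have fst_eq: "fst a = fst b" by simp
  have "(\<lambda>n. \<bar>snd (Z n) - snd (W n)\<bar>) \<longlonglongrightarrow> 0"
    by (rule LIMSEQ_squeeze_zero[OF _ pen(2) inv_m]) simp
  moreover have "(\<lambda>n. \<bar>snd (Z n) - snd (W n)\<bar>) \<longlonglongrightarrow> \<bar>snd a - snd b\<bar>"
    by (intro tendsto_intros Zl Wl)
  ultimately have "\<bar>snd a - snd b\<bar> = 0" by (rule LIMSEQ_unique[symmetric])
  then have "snd a = snd b" by simp
  then have ba: "b = a" using fst_eq by (simp add: prod_eq_iff)
  have "\<Delta> n \<ge> 0" for n
    by (rule order_trans[OF _ pen(1)]) (simp add: less_imp_le[OF m])
  then have "f a - g b - B a \<ge> 0" using LIMSEQ_le_const[OF \<Delta>l] by blast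
  moreover have "f a - g a \<le> B a" by (rule le) (use aQ in \<open>simp add: Q_def\<close>)
  ultimately have touch_a: "f a - g a = B a" using ba by simp
  then have a_int: "a \<in> ball x0 \<rho> \<times> {0<..<t1}" and Ba: "B a > 0"
    using strict[of a] aQ unfolding Q_def by auto
  have \<Delta>0: "\<Delta> \<longlonglongrightarrow> 0" using \<Delta>l touch_a ba by simp
  \<comment> \<open>The (H1) error contains C1 |p| |x - y| = 2 C1 n |x - y|^2, so it is not enough
    that the distance tends to 0.\<close>
  have pen0: "(\<lambda>n. m n * (norm (fst (Z n) - fst (W n)))\<^sup>2) \<longlonglongrightarrow> 0"
    by (rule LIMSEQ_squeeze_zero[OF _ pen(1) \<Delta>0]) (simp add: less_imp_le[OF m])
  have op: "open (ball x0 \<rho> \<times> {0<..<t1})" by (intro open_Times) auto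
  have "\<forall>\<^sub>F n in sequentially. Z n \<in> ball x0 \<rho> \<times> {0<..<t1}"
    by (rule topological_tendstoD[OF Zl op a_int])
  moreover have "\<forall>\<^sub>F n in sequentially. W n \<in> ball x0 \<rho> \<times> {0<..<t1}"
    using topological_tendstoD[OF Wl op] a_int ba by blast
  ultimately have ev: "\<forall>\<^sub>F n in sequentially. (K3 + 1) * B (Z n) - K3 * \<bar>f (Z n) - g (W n)\<bar>
      - C1 * \<beta> * norm (fst (Z n) - fst (W n)) - 2 * C1 * (m n * (norm (fst (Z n) - fst (W n)))\<^sup>2) \<le> 1 / m n"
  proof eventually_elim
    case (elim n)
    obtain x t y s where eq: "Z n = (x,t)" "W n = (y,s)" by (metis surj_pair)
    define p where "p = (2 * m n) *\<^sub>R (x - y)"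
    define q where "q = fst (G (x,t))"
    have tT: "t \<in> {0..T}" using elim eq t1 by auto
    have 1: "snd (G (x,t)) + H x t (f (x,t)) (p + q) - H y t (g (y,s)) p \<le> 1 / m n"
      using ZW[of n] elim unfolding P_def eq p_def q_def by simp
    have 2: "snd (G (x,t)) \<ge> (K3 + 1) * B (x,t) + (A2 * norm x + B2) * norm q"
      unfolding q_def by (rule growth) (use elim eq in auto)
    have 3: "\<bar>H x t (f (x,t)) (p + q) - H x t (f (x,t)) p\<bar> \<le> (A2 * norm x + B2) * norm q"
      using H2[OF tT, of x "f (x,t)" "p + q" p] by (simp add: dist_norm)
    have 4: "\<bar>H x t (f (x,t)) p - H x t (g (y,s)) p\<bar> \<le> K3 * \<bar>f (x,t) - g (y,s)\<bar>"
      by (rule H3[OF tT])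
    have 5: "\<bar>H x t (g (y,s)) p - H y t (g (y,s)) p\<bar> \<le> C1 * (\<beta> + norm p) * norm (x - y)"
      using H1[OF tT] by (simp add: dist_norm)
    have "norm p = 2 * m n * norm (x - y)" using m[of n] by (simp add: p_def)
    then have 6: "C1 * (\<beta> + norm p) * norm (x - y) = C1 * \<beta> * norm (x - y) + 2 * C1 * (m n * (norm (x - y))\<^sup>2)"
      by (simp add: algebra_simps power2_eq_square)
    show ?case using 1 2 3 4 5 6 unfolding eq fst_conv by linarith
  qed
  have "(\<lambda>n. (K3 + 1) * B (Z n) - K3 * \<bar>f (Z n) - g (W n)\<bar>
      - C1 * \<beta> * norm (fst (Z n) - fst (W n)) - 2 * C1 * (m n * (norm (fst (Z n) - fst (W n)))\<^sup>2))
     \<longlonglongrightarrow> (K3 + 1) * B a - K3 * \<bar>f a - g b\<bar> - C1 * \<beta> * norm (fst a - fst b) - 2 * C1 * 0"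
    by (intro tendsto_intros pen0 Zl Wl continuous_on_tendsto_compose[OF fQ Zl aQ]
        continuous_on_tendsto_compose[OF gQ Wl bQ] continuous_on_tendsto_compose[OF BQ Zl aQ])
      (simp_all add: ZQ WQ)
  from tendsto_le[OF _ inv_m this ev]
  have "(K3 + 1) * B a - K3 * \<bar>B a\<bar> \<le> 0" using ba touch_a by simp
  then show False using Ba by (simp add: algebra_simps)
qed

text \<open>The sublevel sets of \<open>q\<close> are cones bounded by the fastest characteristics allowed by (H2);
  \<open>\<epsilon>\<close> smooths the distance to the vertex.\<close>

lemma cone_function:
  fixes x0 :: 'a
  assumes "\<epsilon> > 0"
  obtains q :: "'a \<times> real \<Rightarrow> real" and G where "C1_grad_on UNIV q G"
    "\<And>x t. snd (G (x,t)) \<ge> (A2 * norm x + B2) * norm (fst (G (x,t)))"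
    "\<And>t. q (x0,t) = \<epsilon> * exp (A2 * t) + Rfun A2 B2 x0 t"
    "\<And>x t. t \<ge> 0 \<Longrightarrow> q (x,t) \<ge> dist x0 x"
proof -
  define b where "b = A2 * norm x0 + B2"
  have b: "b \<ge> 0" using A2 B2 by (simp add: b_def)
  \<comment> \<open>E is the integral of exp (A2 s) over [0, t]. It merges the two cases of
    \<open>Rfun\<close> into b E, where b is the speed bound of (H2) at the vertex.\<close>
  define E where "E = (\<lambda>t. if A2 = 0 then t else (exp (A2 * t) - 1) / A2)"
  have E': "(E has_real_derivative exp (A2 * t)) (at t)" for t
    by (cases "A2 = 0") (auto simp: E_def[abs_def] intro!: derivative_eq_intros)
  have E0: "E t \<ge> 0" if "t \<ge> 0" for t
    using that A2 by (auto simp: E_def)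
  have R: "Rfun A2 B2 x0 t = b * E t" for t
    using A2 by (auto simp: Rfun_def E_def b_def field_simps)
  define s where "s = (\<lambda>z::'a \<times> real. sqrt ((norm (fst z - x0))\<^sup>2 + \<epsilon>\<^sup>2))"
  define Gs where "Gs = (\<lambda>z::'a \<times> real. (inverse (s z) / 2) *\<^sub>R ((2 *\<^sub>R (fst z - x0), 0::real) + 0))"
  have pos: "(norm (fst z - x0))\<^sup>2 + \<epsilon>\<^sup>2 > 0" for z :: "'a \<times> real" using assms by (simp add: add_nonneg_pos)
  have s0: "s z > 0" for z using pos[of z] by (simp add: s_def)
  have s_ge: "s z \<ge> norm (fst z - x0)" for z unfolding s_def by (rule real_le_rsqrt) simp
  have sC: "C1_grad_on UNIV s Gs"
    unfolding s_def Gs_def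
    by (intro C1_grad_on_sqrt C1_grad_on_add C1_grad_on_fst_norm_sq C1_grad_on_const pos)
  have ex: "C1_grad_on UNIV (\<lambda>z::'a \<times> real. exp (A2 * (snd z - 0))) (\<lambda>z. exp (A2 * (snd z - 0)) *\<^sub>R (A2 *\<^sub>R (0,1)))"
    by (intro C1_grad_on_exp C1_grad_on_cmult C1_grad_on_snd)
  have EC: "C1_grad_on UNIV (\<lambda>z::'a \<times> real. E (snd z - 0)) (\<lambda>z. exp (A2 * (snd z - 0)) *\<^sub>R (0,1))"
    by (rule C1_grad_on_compose[OF C1_grad_on_snd]) (auto intro: E' continuous_intros)
  \<comment> \<open>The time derivative exp (A2 t) (A2 s + b) is at least exp (A2 t) (A2 |x| + B2),
    because |x| \<le> |x0| + s, and exp (A2 t) bounds the space gradient.\<close>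
  define q where "q = (\<lambda>z. s z * exp (A2 * (snd z - 0)) + b * E (snd z - 0))"
  define G where "G = (\<lambda>z::'a \<times> real. (s z *\<^sub>R (exp (A2 * (snd z - 0)) *\<^sub>R (A2 *\<^sub>R (0,1))) + exp (A2 * (snd z - 0)) *\<^sub>R Gs z)
      + b *\<^sub>R (exp (A2 * (snd z - 0)) *\<^sub>R (0,1::real)))"
  show thesis
  proof (rule that)
    show "C1_grad_on UNIV q G"
      unfolding q_def G_def by (intro C1_grad_on_add C1_grad_on_cmult C1_grad_on_mult sC ex EC)
    fix x t
    show "q (x0,t) = \<epsilon> * exp (A2 * t) + Rfun A2 B2 x0 t"
      using assms by (simp add: q_def R s_def)
    define c where "c = s (x,t)"
    have c: "c > 0" "c \<ge> norm (x - x0)" using s0[of "(x,t)"] s_ge[of "(x,t)"] by (auto simp: c_def)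
    have fs: "fst (G (x,t)) = exp (A2 * t) *\<^sub>R ((inverse c / 2) *\<^sub>R (2 *\<^sub>R (x - x0)))"
      and sn: "snd (G (x,t)) = exp (A2 * t) * (A2 * c + b)"
      by (simp_all add: G_def Gs_def c_def algebra_simps)
    have "norm (fst (G (x,t))) = exp (A2 * t) * (norm (x - x0) / c)"
      unfolding fs norm_scaleR using c by (simp add: inverse_eq_divide)
    also have "\<dots> \<le> exp (A2 * t) * 1" using c by (intro mult_left_mono) (auto simp: divide_le_eq_1)
    finally have n1: "norm (fst (G (x,t))) \<le> exp (A2 * t)" by simp
    have "norm x \<le> norm x0 + c" using norm_triangle_sub[of x x0] c by linarith
    then have "A2 * norm x \<le> A2 * (norm x0 + c)" using A2 by (rule mult_left_mono)
    then have "A2 * norm x + B2 \<le> A2 * c + b" by (simp add: b_def algebra_simps)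
    then have "(A2 * norm x + B2) * norm (fst (G (x,t))) \<le> (A2 * c + b) * exp (A2 * t)"
      using n1 A2 B2 b c by (intro mult_mono) auto
    then show "(A2 * norm x + B2) * norm (fst (G (x,t))) \<le> snd (G (x,t))"
      unfolding sn by (simp add: mult.commute)
    assume t: "t \<ge> 0"
    have "c * 1 \<le> c * exp (A2 * t)" using c t A2 by (intro mult_left_mono) auto
    moreover have "b * E t \<ge> 0" using b E0[OF t] by simp
    moreover have "q (x,t) = c * exp (A2 * t) + b * E t" by (simp add: q_def c_def)
    moreover have "dist x0 x = norm (x - x0)" by (simp add: dist_norm norm_minus_commute)
    ultimately show "dist x0 x \<le> q (x,t)" using c by linarith
  qed
qed

text \<open>An increasing function of the cone function inherits its gradient inequality, so a steep
  exponential turns the cone into a barrier: small at the vertex, above M outside the base ball. The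
  second exponential, in time alone, closes the cylinder at the top.\<close>

lemma cone_barrier:
  fixes x0 :: 'a
  assumes "t0 < t1" "\<delta> > 0" "\<eta> > 0"
  obtains k :: "'a \<times> real \<Rightarrow> real" and G where "C1_grad_on UNIV k G" "\<And>z. k z \<ge> 0"
    "\<And>x t. snd (G (x,t)) \<ge> (A2 * norm x + B2) * norm (fst (G (x,t)))"
    "k (x0,t0) < \<eta>" "\<And>x. k (x,t1) > M"
    "\<And>x t. t \<ge> 0 \<Longrightarrow> dist x0 x \<ge> Rfun A2 B2 x0 t0 + \<delta> \<Longrightarrow> k (x,t) > M"
proof -
  \<comment> \<open>Makes \<epsilon> exp (A2 t0) = \<delta> / 4, so that q at the vertex is \<delta>
    / 4 below the level c, while on the lateral boundary it is at least \<delta> / 2 above.\<close>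
  define \<epsilon> where "\<epsilon> = \<delta> / 4 * exp (- (A2 * t0))"
  have \<epsilon>: "\<epsilon> > 0" using assms by (simp add: \<epsilon>_def)
  obtain q :: "'a \<times> real \<Rightarrow> real" and Gq where q: "C1_grad_on UNIV q Gq"
    "\<And>x t. snd (Gq (x,t)) \<ge> (A2 * norm x + B2) * norm (fst (Gq (x,t)))"
    "\<And>t. q (x0,t) = \<epsilon> * exp (A2 * t) + Rfun A2 B2 x0 t"
    "\<And>x t. t \<ge> 0 \<Longrightarrow> q (x,t) \<ge> dist x0 x"
    using cone_function[OF \<epsilon>, of x0] by metis
  define c where "c = Rfun A2 B2 x0 t0 + \<delta> / 2"
  define tm where "tm = (t0 + t1) / 2"
  define a where "a = min (\<delta> / 4) (t1 - tm)"
  have a: "a > 0" "a \<le> \<delta> / 4" "a \<le> t1 - tm" "a \<le> tm - t0" using assms unfolding a_def tm_def min_def by (auto simp: field_simps)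
  obtain N where N: "N > 0" "exp (- N * a) < \<eta> / 2" "exp (N * a) > M"
    using exp_scale_small_large[of a a "\<eta> / 2" M] a assms by auto
  define k where "k = (\<lambda>z. exp (N * (q z + - c)) + exp (N * (snd z - tm)))"
  define G where "G = (\<lambda>z. exp (N * (q z + - c)) *\<^sub>R (N *\<^sub>R (Gq z + 0)) + exp (N * (snd z - tm)) *\<^sub>R (N *\<^sub>R (0 :: 'a, 1 :: real)))"
  have mono: "exp (N * u) \<le> exp (N * v)" if "u \<le> v" for u v using that N by simp
  show thesis
  proof (rule that)
    show "C1_grad_on UNIV k G"
      unfolding k_def G_def
      by (intro C1_grad_on_add C1_grad_on_exp C1_grad_on_cmult C1_grad_on_snd C1_grad_on_const q)
    show "k z \<ge> 0" for z by (simp add: k_def add_nonneg_nonneg)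
    fix x t
    define r where "r = exp (N * (q (x,t) + - c)) * N"
    have r: "r \<ge> 0" using N by (simp add: r_def)
    have fs: "fst (G (x,t)) = r *\<^sub>R fst (Gq (x,t))"
      and sn: "snd (G (x,t)) = r * snd (Gq (x,t)) + exp (N * (t - tm)) * N"
      by (simp_all add: G_def r_def)
    have "r * ((A2 * norm x + B2) * norm (fst (Gq (x,t)))) \<le> r * snd (Gq (x,t))"
      using q(2) r by (rule mult_left_mono)
    moreover have "exp (N * (t - tm)) * N \<ge> 0" using N by simp
    ultimately show "(A2 * norm x + B2) * norm (fst (G (x,t))) \<le> snd (G (x,t))"
      unfolding sn unfolding fs norm_scaleR using r by (simp add: mult_ac)
    show "k (x0,t0) < \<eta>"
    proof -
      have "\<epsilon> * exp (A2 * t0) = \<delta> / 4" by (simp add: \<epsilon>_def exp_minus)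
      then have "q (x0,t0) + - c \<le> - a" unfolding q(3) c_def using a by simp
      then have "exp (N * (q (x0,t0) + - c)) \<le> exp (N * (- a))" by (rule mono)
      moreover have "exp (N * (t0 - tm)) \<le> exp (N * (- a))" using a by (intro mono) simp
      moreover have "exp (N * (- a)) = exp (- N * a)" by simp
      ultimately show ?thesis using N unfolding k_def snd_conv by linarith
    qed
    show "k (x,t1) > M"
    proof -
      have "exp (N * (t1 - tm)) \<ge> exp (N * a)" using a by (intro mono) simp
      then show ?thesis using N exp_ge_zero[of "N * (q (x,t1) + - c)"] unfolding k_def snd_conv by linarith
    qed
    assume "t \<ge> 0" "dist x0 x \<ge> Rfun A2 B2 x0 t0 + \<delta>"
    then have "q (x,t) + - c \<ge> a" using q(4)[of t x] a assms unfolding c_def by linarith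
    then have "exp (N * (q (x,t) + - c)) \<ge> exp (N * a)" by (rule mono)
    then show "k (x,t) > M" using N exp_ge_zero[of "N * (t - tm)"] unfolding k_def snd_conv by linarith
  qed
qed

lemma Rfun_nonneg: "t \<ge> 0 \<Longrightarrow> Rfun A2 B2 x t \<ge> 0"
  using A2 B2 by (auto simp: Rfun_def intro!: mult_nonneg_nonneg add_nonneg_nonneg)

text \<open>If f > g at the vertex, exp (- \<nu> t) (f - g) - k has a positive maximum \<mu> on a
  cylinder, so exp (\<nu> t) (\<mu> + k) touches f - g from above. The initial data exclude contact
  at the bottom and the size of k excludes the side and the top, which contradicts
  \<open>no_touching_barrier\<close>; \<nu> = K3 + 1 is the rate demanded there.\<close>

theorem comparison_in_cone:
  fixes f g :: "'a \<times> real \<Rightarrow> real"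
  assumes fc: "continuous_on (UNIV \<times> {0..<T}) f" and gc: "continuous_on (UNIV \<times> {0..<T}) g"
    and f: "visc_ineq T T' 1 H f" and g: "visc_ineq T T' 1 (\<lambda>x t r p. - neg_H x t r p) (\<lambda>z. - g z)"
    and t0: "0 < t0" "t0 < T'" "T' \<le> T" and \<delta>: "\<delta> > 0"
    and init: "\<And>y. y \<in> cball x0 (Rfun A2 B2 x0 t0 + \<delta>) \<Longrightarrow> f (y,0) \<le> g (y,0)"
  shows "f (x0,t0) \<le> g (x0,t0)"
proof (rule ccontr)
  assume "\<not> ?thesis"
  then have d0: "f (x0,t0) - g (x0,t0) > 0" by simp
  define \<rho> where "\<rho> = Rfun A2 B2 x0 t0 + \<delta>"
  have \<rho>: "\<rho> > 0" using Rfun_nonneg[of t0 x0] t0 \<delta> by (simp add: \<rho>_def)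
  define t1 where "t1 = (t0 + T') / 2"
  have t1: "t0 < t1" "t1 < T'" "0 < t1" using t0 by (auto simp: t1_def)
  define \<nu> where "\<nu> = K3 + 1"
  have \<nu>: "\<nu> > 0" using K3 by (simp add: \<nu>_def)
  define Q where "Q = cball x0 \<rho> \<times> {0..t1}"
  have Q: "compact Q" unfolding Q_def by (intro compact_Times compact_cball compact_Icc)
  have QT: "Q \<subseteq> UNIV \<times> {0..<T}" using t1 t0 by (auto simp: Q_def)
  have fQ: "continuous_on Q f" and gQ: "continuous_on Q g"
    using fc gc QT by (auto elim: continuous_on_subset)
  have "bounded ((\<lambda>z. f z - g z) ` Q)"
    by (intro compact_imp_bounded compact_continuous_image continuous_intros fQ gQ Q)
  then obtain M where M: "\<And>z. z \<in> Q \<Longrightarrow> \<bar>f z - g z\<bar> \<le> M" unfolding bounded_iff by auto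
  have "exp (- (\<nu> * t0)) * (f (x0,t0) - g (x0,t0)) > 0" using d0 by simp
  then obtain k :: "'a \<times> real \<Rightarrow> real" and Gk where k: "C1_grad_on UNIV k Gk" "\<And>z. k z \<ge> 0"
    "\<And>x t. snd (Gk (x,t)) \<ge> (A2 * norm x + B2) * norm (fst (Gk (x,t)))"
    "k (x0,t0) < exp (- (\<nu> * t0)) * (f (x0,t0) - g (x0,t0))" "\<And>x. k (x,t1) > M"
    "\<And>x t. t \<ge> 0 \<Longrightarrow> dist x0 x \<ge> Rfun A2 B2 x0 t0 + \<delta> \<Longrightarrow> k (x,t) > M"
    using cone_barrier[OF t1(1) \<delta>] by metis
  have kc: "continuous_on X k" for X
    using C1_grad_on_imp_continuous_on[OF k(1)] continuous_on_subset by blast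
  define \<Psi> where "\<Psi> = (\<lambda>z. exp (- (\<nu> * snd z)) * (f z - g z) - k z)"
  have x0Q: "(x0,t0) \<in> Q" using \<rho> t0 t1 by (simp add: Q_def)
  have "continuous_on Q \<Psi>" unfolding \<Psi>_def by (intro continuous_intros fQ gQ kc)
  then have "\<exists>z\<in>Q. \<forall>y\<in>Q. \<Psi> y \<le> \<Psi> z" using x0Q by (intro continuous_attains_sup Q) auto
  then obtain z1 where z1: "z1 \<in> Q" "\<And>y. y \<in> Q \<Longrightarrow> \<Psi> y \<le> \<Psi> z1" by blast
  define \<mu> where "\<mu> = \<Psi> z1"
  have \<mu>: "\<mu> > 0" using z1(2)[OF x0Q] k(4) by (simp add: \<mu>_def \<Psi>_def)
  define B where "B = (\<lambda>z. exp (\<nu> * (snd z - 0)) * (\<mu> + k z))"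
  define G where "G = (\<lambda>z. exp (\<nu> * (snd z - 0)) *\<^sub>R (0 + Gk z) + (\<mu> + k z) *\<^sub>R (exp (\<nu> * (snd z - 0)) *\<^sub>R (\<nu> *\<^sub>R (0::'a,1::real))))"
  have BC: "C1_grad_on UNIV B G"
    unfolding B_def G_def
    by (intro C1_grad_on_mult C1_grad_on_exp C1_grad_on_cmult C1_grad_on_snd C1_grad_on_add C1_grad_on_const k(1))
  have B\<Psi>: "f z - g z - B z = exp (\<nu> * snd z) * (\<Psi> z - \<mu>)" for z
    by (simp add: B_def \<Psi>_def exp_minus field_simps)
  have "f z1 - g z1 \<noteq> B z1"
  proof (rule no_touching_barrier[OF fc gc _ f g _ t1(3,2) t0(3)])
    show "continuous_on (UNIV \<times> {0..<T}) B"
      using C1_grad_on_imp_continuous_on[OF BC] by (rule continuous_on_subset) simp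
    show "C1_grad_on (UNIV \<times> {0<..<T}) B G"
      using BC unfolding C1_grad_on_def by (auto elim: continuous_on_subset)
    show "z1 \<in> cball x0 \<rho> \<times> {0..t1}" using z1 by (simp add: Q_def)
  next
    fix z assume "z \<in> cball x0 \<rho> \<times> {0..t1}"
    then have "\<Psi> z \<le> \<mu>" using z1(2) by (simp add: \<mu>_def Q_def)
    then have "exp (\<nu> * snd z) * (\<Psi> z - \<mu>) \<le> 0" by (simp add: mult_nonneg_nonpos)
    then show "f z - g z \<le> B z" using B\<Psi>[of z] by linarith
  next
    fix x t
    define c where "c = exp (\<nu> * t)"
    have c: "c > 0" by (simp add: c_def)
    have "fst (G (x,t)) = c *\<^sub>R fst (Gk (x,t))" "snd (G (x,t)) = c * snd (Gk (x,t)) + \<nu> * B (x,t)"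
      by (simp_all add: G_def B_def c_def)
    moreover have "c * ((A2 * norm x + B2) * norm (fst (Gk (x,t)))) \<le> c * snd (Gk (x,t))"
      using k(3) c by (intro mult_left_mono) auto
    ultimately show "(K3 + 1) * B (x,t) + (A2 * norm x + B2) * norm (fst (G (x,t))) \<le> snd (G (x,t))"
      using c by (simp add: \<nu>_def mult_ac)
  next
    fix z assume zQ: "z \<in> cball x0 \<rho> \<times> {0..t1}" and eq: "f z - g z = B z"
    obtain x t where z: "z = (x,t)" by (cases z)
    have t: "0 \<le> t" "t \<le> t1" and x: "x \<in> cball x0 \<rho>" using zQ z by auto
    have Bpos: "B z > 0" unfolding B_def using \<mu> k(2)[of z] by (simp add: add_pos_nonneg)
    have "1 * k z \<le> exp (\<nu> * (snd z - 0)) * (\<mu> + k z)"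
      using \<mu> k(2)[of z] t \<nu> z by (intro mult_mono) auto
    \<comment> \<open>At a contact f - g = B \<ge> k, as the factor exp (\<nu> t) is at least 1;
      hence there is no contact where k > M.\<close>
    then have kM: "k z \<le> M" using M[of z] zQ eq unfolding B_def Q_def by linarith
    have "t \<noteq> 0" using init[of x] x eq Bpos unfolding z \<rho>_def by force
    moreover have "t \<noteq> t1" using k(5)[of x] kM unfolding z by force
    moreover have "dist x0 x < \<rho>" using k(6)[OF t(1), of x] kM unfolding z \<rho>_def by force
    ultimately show "z \<in> ball x0 \<rho> \<times> {0<..<t1} \<and> B z > 0" using t Bpos z by auto
  qed
  then show False using B\<Psi>[of z1] by (simp add: \<mu>_def)
qed

end

section \<open>Suprema over moving balls\<close>

text \<open>With the displacement written as \<rho>(t) e, e in the unit ball, the supremum runs over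
  one fixed compact set. This gives continuity in (x, t), and a maximising e can be kept while x and
  t vary.\<close>

definition moving_sup :: "('a::euclidean_space \<times> real \<Rightarrow> real) \<Rightarrow> (real \<Rightarrow> real) \<Rightarrow> (real \<Rightarrow> real)
    \<Rightarrow> 'a \<times> real \<Rightarrow> real" where
  "moving_sup V \<rho> \<eta> z = (SUP e\<in>cball 0 1. V (fst z + \<rho> (snd z) *\<^sub>R e, snd z)) - \<eta> (snd z)"

lemma continuous_on_SUP_compact:
  fixes f :: "'b::topological_space \<times> 'c::topological_space \<Rightarrow> real"
  assumes f: "continuous_on (X \<times> K) f" and K: "compact K" "K \<noteq> {}"
  shows "continuous_on X (\<lambda>x. SUP k\<in>K. f (x,k))"
  unfolding continuous_on_def
proof (intro ballI tendstoI)
  fix x and \<epsilon> :: real assume x: "x \<in> X" and "\<epsilon> > 0"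
  then have "\<epsilon> / 2 > 0" by simp
  then obtain U where U: "x \<in> U" "open U" "\<forall>y\<in>U \<inter> X. \<forall>k\<in>K. dist (f (y,k)) (f (x,k)) \<le> \<epsilon> / 2"
    by (rule continuous_on_prod_compactE[OF f K(1) x])
  have bdd: "bdd_above ((\<lambda>k. f (y,k)) ` K)" if "y \<in> X" for y
  proof -
    have "continuous_on K (\<lambda>k. f (y,k))"
      by (rule continuous_on_compose2[OF f]) (use that in \<open>auto intro!: continuous_intros\<close>)
    then show ?thesis by (intro bounded_imp_bdd_above compact_imp_bounded compact_continuous_image K)
  qed
  have le: "(SUP k\<in>K. f (y,k)) \<le> (SUP k\<in>K. f (w,k)) + \<epsilon> / 2"
    if "w \<in> X" "\<And>k. k \<in> K \<Longrightarrow> dist (f (y,k)) (f (w,k)) \<le> \<epsilon> / 2" for y w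
  proof (rule cSUP_least[OF K(2)])
    fix k assume k: "k \<in> K"
    have "f (y,k) \<le> f (w,k) + \<epsilon> / 2" using that(2)[OF k] unfolding dist_real_def by linarith
    then show "f (y,k) \<le> (SUP k\<in>K. f (w,k)) + \<epsilon> / 2"
      using cSUP_upper[OF k bdd[OF that(1)]] by linarith
  qed
  have "dist (SUP k\<in>K. f (y,k)) (SUP k\<in>K. f (x,k)) < \<epsilon>" if "y \<in> U" "y \<in> X" for y
  proof -
    have "(SUP k\<in>K. f (y,k)) \<le> (SUP k\<in>K. f (x,k)) + \<epsilon> / 2"
      using U(3) that by (intro le[OF x]) blast
    moreover have "(SUP k\<in>K. f (x,k)) \<le> (SUP k\<in>K. f (y,k)) + \<epsilon> / 2"
      using U(3) that by (intro le[OF that(2)]) (subst dist_commute, blast)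
    ultimately show ?thesis using \<open>\<epsilon> > 0\<close> unfolding dist_real_def by linarith
  qed
  then show "\<forall>\<^sub>F y in at x within X. dist (SUP k\<in>K. f (y,k)) (SUP k\<in>K. f (x,k)) < \<epsilon>"
    using U(1,2) unfolding eventually_at_topological by blast
qed

lemma continuous_on_moving_sup:
  fixes V :: "'a::euclidean_space \<times> real \<Rightarrow> real"
  assumes V: "continuous_on (UNIV \<times> J) V" and "continuous_on J \<rho>" "continuous_on J \<eta>"
  shows "continuous_on (UNIV \<times> J) (moving_sup V \<rho> \<eta>)"
proof -
  let ?f = "\<lambda>(z,e). V (fst z + \<rho> (snd z) *\<^sub>R e, snd z)"
  have \<rho>': "continuous_on ((UNIV \<times> J) \<times> cball (0::'a) 1) (\<lambda>w. \<rho> (snd (fst w)))"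
    by (rule continuous_on_compose2[OF assms(2)]) (auto intro!: continuous_intros)
  have "continuous_on ((UNIV \<times> J) \<times> cball 0 1) ?f"
    unfolding case_prod_beta
    by (rule continuous_on_compose2[OF V]) (auto intro!: continuous_intros \<rho>')
  from continuous_on_SUP_compact[OF this] 
  have "continuous_on (UNIV \<times> J) (\<lambda>z. SUP e\<in>cball 0 1. ?f (z,e))" by simp
  moreover have "continuous_on (UNIV \<times> J) (\<lambda>z. \<eta> (snd z))"
    by (rule continuous_on_compose2[OF assms(3)]) (auto intro!: continuous_intros)
  ultimately show ?thesis
    unfolding moving_sup_def[abs_def] by (intro continuous_on_diff) auto
qed

lemma
  fixes V :: "'a::euclidean_space \<times> real \<Rightarrow> real"
  assumes "continuous_on UNIV (\<lambda>x. V (x,t))"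
  shows moving_sup_upper: "norm e \<le> 1 \<Longrightarrow> V (x + \<rho> t *\<^sub>R e, t) - \<eta> t \<le> moving_sup V \<rho> \<eta> (x,t)"
    and moving_sup_attained: "\<exists>e. norm e \<le> 1 \<and> moving_sup V \<rho> \<eta> (x,t) = V (x + \<rho> t *\<^sub>R e, t) - \<eta> t"
proof -
  have c: "continuous_on (cball 0 1) (\<lambda>e. V (x + \<rho> t *\<^sub>R e, t))"
    by (rule continuous_on_compose2[OF assms]) (auto intro!: continuous_intros)
  have "bdd_above ((\<lambda>e. V (x + \<rho> t *\<^sub>R e, t)) ` cball 0 1)"
    by (intro bounded_imp_bdd_above compact_imp_bounded compact_continuous_image c compact_cball)
  then have up: "V (x + \<rho> t *\<^sub>R e, t) \<le> (SUP e\<in>cball 0 1. V (x + \<rho> t *\<^sub>R e, t))" if "norm e \<le> 1" for e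
    using that by (intro cSUP_upper) auto
  then show "norm e \<le> 1 \<Longrightarrow> V (x + \<rho> t *\<^sub>R e, t) - \<eta> t \<le> moving_sup V \<rho> \<eta> (x,t)"
    by (simp add: moving_sup_def)
  have "\<exists>e\<in>cball 0 1. \<forall>y\<in>cball 0 1. V (x + \<rho> t *\<^sub>R y, t) \<le> V (x + \<rho> t *\<^sub>R e, t)"
    by (intro continuous_attains_sup c compact_cball) auto
  then obtain e where e: "e \<in> cball 0 1" "\<And>y. y \<in> cball 0 1 \<Longrightarrow> V (x + \<rho> t *\<^sub>R y, t) \<le> V (x + \<rho> t *\<^sub>R e, t)"
    by blast
  then have "(SUP e\<in>cball 0 1. V (x + \<rho> t *\<^sub>R e, t)) \<le> V (x + \<rho> t *\<^sub>R e, t)"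
    by (intro cSUP_least) auto
  then show "\<exists>e. norm e \<le> 1 \<and> moving_sup V \<rho> \<eta> (x,t) = V (x + \<rho> t *\<^sub>R e, t) - \<eta> t"
    using up[of e] e(1) by (intro exI[of _ e]) (simp add: moving_sup_def)
qed

lemma moving_sup_lipschitz:
  fixes V :: "'a::euclidean_space \<times> real \<Rightarrow> real"
  assumes V: "continuous_on UNIV (\<lambda>x. V (x,t))"
    and lip: "\<And>x y. \<bar>V (x,t) - V (y,t)\<bar> \<le> L * dist x y"
  shows "\<bar>moving_sup V \<rho> \<eta> (x,t) - moving_sup V \<rho> \<eta> (y,t)\<bar> \<le> L * dist x y"
proof -
  have *: "moving_sup V \<rho> \<eta> (x,t) \<le> moving_sup V \<rho> \<eta> (y,t) + L * dist x y" for x y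
  proof -
    obtain e where e: "norm e \<le> 1" "moving_sup V \<rho> \<eta> (x,t) = V (x + \<rho> t *\<^sub>R e, t) - \<eta> t"
      using moving_sup_attained[OF V] by blast
    have "V (x + \<rho> t *\<^sub>R e, t) - V (y + \<rho> t *\<^sub>R e, t) \<le> L * dist x y"
      using lip[of "x + \<rho> t *\<^sub>R e" "y + \<rho> t *\<^sub>R e"] by (simp add: abs_le_iff)
    then show ?thesis using moving_sup_upper[OF V e(1), of y \<rho> \<eta>] e(2) by linarith
  qed
  from *[of x y] *[of y x] show ?thesis by (simp add: dist_commute abs_le_iff)
qed

text \<open>At a contact point with maximiser e, the sheared function \<phi> (y - \<rho>(s) e, s) +
  \<eta>(s) touches V at (x + \<rho>(t) e, t). Since \<sigma> \<rho>' = - C1 \<rho>, its time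
  derivative times \<sigma> gains C1 \<rho> (e \<bullet> p), which is at least C1 \<rho> |p| and
  cancels that part of the (H1) error. The rest, C1 \<beta> \<rho> + K3 |\<eta>|, is covered by
  \<sigma> \<eta>'.\<close>

lemma visc_ineq_moving_sup:
  fixes V :: "'a::euclidean_space \<times> real \<Rightarrow> real"
  assumes V: "visc_ineq T T' \<sigma> F V" "continuous_on (UNIV \<times> {0..<T}) V" and T': "T' \<le> T" and \<sigma>: "\<sigma> * \<sigma> = 1"
    and C1: "C1 \<ge> 0" and \<beta>: "\<beta> \<ge> 0"
    and F1: "\<And>x y t r p. t \<in> {0..T} \<Longrightarrow> \<bar>F x t r p - F y t r p\<bar> \<le> C1 * (\<beta> + norm p) * dist x y"
    and F3: "\<And>x t r s p. t \<in> {0..T} \<Longrightarrow> \<bar>F x t r p - F x t s p\<bar> \<le> K3 * \<bar>r - s\<bar>"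
    and \<rho>: "\<And>t. (\<rho> has_real_derivative - \<sigma> * C1 * \<rho> t) (at t)" "\<And>t. \<rho> t > 0"
    and \<eta>: "\<And>t. (\<eta> has_real_derivative \<eta>' t) (at t)" "continuous_on UNIV \<eta>'"
      "\<And>t. 0 < t \<Longrightarrow> t < T' \<Longrightarrow> C1 * \<beta> * \<rho> t + K3 * \<bar>\<eta> t\<bar> \<le> \<sigma> * \<eta>' t"
  shows "visc_ineq T T' \<sigma> F (moving_sup V \<rho> \<eta>)"
  unfolding visc_ineq_def
proof (intro allI impI, elim conjE exE)
  let ?W = "moving_sup V \<rho> \<eta>"
  fix \<phi> G x t \<epsilon>
  assume C: "C1_grad_on (UNIV \<times> {0<..<T}) \<phi> G" and t: "0 < t" "t < T'" and \<epsilon>: "\<epsilon> > 0"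
    and touch: "\<forall>z\<in>ball (x,t) \<epsilon> \<inter> UNIV \<times> {0<..<T}. ?W z - \<phi> z \<le> ?W (x,t) - \<phi> (x,t)"
  have tT: "t < T" using t T' by simp
  have Vt: "continuous_on UNIV (\<lambda>x. V (x,s))" if "0 < s" "s < T" for s
    by (rule continuous_on_compose2[OF V(2)]) (use that in \<open>auto intro!: continuous_intros\<close>)
  obtain e where e: "norm e \<le> 1" "?W (x,t) = V (x + \<rho> t *\<^sub>R e, t) - \<eta> t"
    using moving_sup_attained[OF Vt[OF t(1) tT]] by blast
  define p \<tau> where "p = fst (G (x,t))" and "\<tau> = snd (G (x,t))"
  have G: "G (x,t) = (p,\<tau>)" by (simp add: p_def \<tau>_def)
  have \<phi>': "(\<phi> has_derivative (\<lambda>h. (p,\<tau>) \<bullet> h)) (at (x,t))"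
    using C1_grad_on_has_derivative[OF C, of "(x,t)"] t tT G by simp
  \<comment> \<open>First-order optimality of \<open>e\<close>: moving the centre by \<open>\<rho> (e - e')\<close> does not decrease the supremum.\<close>
  have align: "norm p \<le> e \<bullet> p"
  proof -
    define e' where "e' = sgn p"
    have e': "norm e' \<le> 1" "p \<bullet> e' = norm p"
      by (simp_all add: e'_def norm_sgn sgn_div_norm dot_square_norm power2_eq_square inverse_eq_divide)
    define v where "v = (- (\<rho> t) *\<^sub>R (e' - e), 0::real)"
    have "\<forall>\<^sub>F h in at_right 0. (\<lambda>z. - \<phi> z) ((x,t) + h *\<^sub>R v) - (- \<phi> (x,t)) \<le> 0 * h"
      using eventually_at_right_in_ball[OF \<epsilon>, of "(x,t)" v] eventually_at_right_less[of 0]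
        eventually_at_right_real[of 0 1, OF zero_less_one]
    proof eventually_elim
      case (elim h)
      \<comment> \<open>From the centre \<open>xh\<close> the displacement \<open>eh\<close> reaches
        the same point x + \<rho> e, and it is admissible because the unit ball is convex.\<close>
      define eh where "eh = e + h *\<^sub>R (e' - e)"
      define xh where "xh = x - (h * \<rho> t) *\<^sub>R (e' - e)"
      have "eh = (1 - h) *\<^sub>R e + h *\<^sub>R e'" by (simp add: eh_def algebra_simps)
      moreover have "\<bar>1 - h\<bar> * norm e + \<bar>h\<bar> * norm e' \<le> (1 - h) * 1 + h * 1"
        using elim e(1) e'(1) by (intro add_mono mult_mono) auto
      ultimately have eh: "norm eh \<le> 1"
        using norm_triangle_ineq[of "(1 - h) *\<^sub>R e" "h *\<^sub>R e'"] by simp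
      have eq: "(x,t) + h *\<^sub>R v = (xh,t)" by (simp add: v_def xh_def algebra_simps)
      have "xh + \<rho> t *\<^sub>R eh = x + \<rho> t *\<^sub>R e" by (simp add: xh_def eh_def algebra_simps)
      then have "?W (x,t) \<le> ?W (xh,t)"
        using moving_sup_upper[OF Vt[OF t(1) tT] eh, of xh \<rho> \<eta>] e(2) by simp
      moreover have "?W (xh,t) - \<phi> (xh,t) \<le> ?W (x,t) - \<phi> (x,t)"
        using touch elim(1) t tT unfolding eq by auto
      ultimately show ?case unfolding eq by simp
    qed
    moreover have "((\<lambda>z. - \<phi> z) has_derivative (\<lambda>h. (- (p,\<tau>)) \<bullet> h)) (at (x,t))"
      using has_derivative_minus[OF \<phi>'] by (simp add: inner_prod_def)
    ultimately have "(- (p,\<tau>)) \<bullet> v \<le> 0" by (intro gradient_directional_le[where \<phi> = "\<lambda>z. - \<phi> z"]) 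
    then have "\<rho> t * (p \<bullet> (e' - e)) \<le> 0" by (simp add: v_def inner_prod_def)
    then have "p \<bullet> (e' - e) \<le> 0" using \<rho>(2)[of t] by (simp add: mult_le_0_iff)
    then show ?thesis using e'(2) by (simp add: inner_diff_right inner_commute)
  qed
  have \<rho>c: "continuous_on UNIV (\<lambda>t. - \<sigma> * C1 * \<rho> t)"
    by (intro continuous_intros continuous_at_imp_continuous_on ballI DERIV_isCont[OF \<rho>(1)])
  have \<eta>C: "C1_grad_on (UNIV \<times> {0<..<T}) (\<lambda>z::'a \<times> real. \<eta> (snd z - 0)) (\<lambda>z. \<eta>' (snd z - 0) *\<^sub>R (0,1))"
    by (rule C1_grad_on_compose[OF C1_grad_on_snd \<eta>(1)]) (use \<eta>(2) continuous_on_subset in blast)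
  define X where "X = (\<lambda>z::'a \<times> real. (fst z - \<rho> (snd z) *\<^sub>R e, snd z))"
  define z1 where "z1 = (x + \<rho> t *\<^sub>R e, t)"
  have Xz1: "X z1 = (x,t)" by (simp add: X_def z1_def)
  have "isCont \<rho> t" using \<rho>(1) DERIV_isCont by blast
  then have "isCont X z1" unfolding X_def z1_def
    by (auto intro!: continuous_intros isCont_o2[where g = \<rho> and f = snd])
  then have "\<forall>\<^sub>F z in nhds z1. X z \<in> ball (x,t) \<epsilon>"
    using \<epsilon> Xz1 unfolding isCont_def tendsto_at_iff_tendsto_nhds
    by (metis centre_in_ball open_ball topological_tendstoD)
  then obtain \<epsilon>1 where \<epsilon>1: "\<epsilon>1 > 0" "\<And>z. dist z z1 < \<epsilon>1 \<Longrightarrow> X z \<in> ball (x,t) \<epsilon>"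
    unfolding eventually_nhds_metric by blast
  note D = C1_grad_on_add[OF C1_grad_on_shear[OF C \<rho>(1) \<rho>c, of e] \<eta>C]
  have "V z - (\<phi> (fst z - \<rho> (snd z) *\<^sub>R e, snd z) + \<eta> (snd z - 0)) \<le>
      V (x + \<rho> t *\<^sub>R e, t) - (\<phi> (fst (x + \<rho> t *\<^sub>R e, t) - \<rho> (snd (x + \<rho> t *\<^sub>R e, t)) *\<^sub>R e, snd (x + \<rho> t *\<^sub>R e, t)) + \<eta> (snd (x + \<rho> t *\<^sub>R e, t) - 0))"
    if z: "z \<in> ball (x + \<rho> t *\<^sub>R e, t) \<epsilon>1" "0 < snd z" "snd z < T" for z
  proof -
    obtain y s where zs: "z = (y,s)" by (cases z)
    have "X z \<in> ball (x,t) \<epsilon>" using \<epsilon>1(2)[of z] z(1) by (simp add: z1_def dist_commute)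
    then have "?W (X z) - \<phi> (X z) \<le> ?W (x,t) - \<phi> (x,t)"
      using touch z(2,3) by (auto simp: X_def)
    moreover have "V z - \<eta> s \<le> ?W (X z)"
      using moving_sup_upper[OF Vt[of s] e(1), of "y - \<rho> s *\<^sub>R e" \<rho> \<eta>] z(2,3) zs by (simp add: X_def)
    ultimately show ?thesis using e(2) zs by (simp add: X_def)
  qed
  from visc_ineqD[OF V(1) D t \<epsilon>1(1) this]
  have "\<sigma> * (\<tau> + \<sigma> * C1 * \<rho> t * (e \<bullet> p) + \<eta>' t) + F (x + \<rho> t *\<^sub>R e) t (V (x + \<rho> t *\<^sub>R e, t)) p \<le> 0"
    by (simp add: G)
  moreover have "\<sigma> * (\<tau> + \<sigma> * C1 * \<rho> t * (e \<bullet> p) + \<eta>' t) = \<sigma> * \<tau> + C1 * \<rho> t * (e \<bullet> p) + \<sigma> * \<eta>' t"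
  proof -
    have "\<sigma> * (\<sigma> * C1 * \<rho> t * (e \<bullet> p)) = (\<sigma> * \<sigma>) * (C1 * \<rho> t * (e \<bullet> p))" by (simp only: mult_ac)
    then show ?thesis using \<sigma> by (simp add: distrib_left)
  qed
  moreover have "C1 * \<rho> t * norm p \<le> C1 * \<rho> t * (e \<bullet> p)"
    using align C1 \<rho>(2)[of t] by (intro mult_left_mono) auto
  moreover have "\<bar>F (x + \<rho> t *\<^sub>R e) t (V (x + \<rho> t *\<^sub>R e, t)) p - F x t (V (x + \<rho> t *\<^sub>R e, t)) p\<bar>
      \<le> C1 * \<beta> * \<rho> t + C1 * \<rho> t * norm p"
  proof -
    have "dist (x + \<rho> t *\<^sub>R e) x \<le> \<rho> t"
      using e(1) \<rho>(2)[of t] by (simp add: dist_norm mult_left_le)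
    then have "C1 * (\<beta> + norm p) * dist (x + \<rho> t *\<^sub>R e) x \<le> C1 * (\<beta> + norm p) * \<rho> t"
      using C1 \<beta> by (intro mult_left_mono) auto
    then show ?thesis
      using F1[of t "x + \<rho> t *\<^sub>R e" "V (x + \<rho> t *\<^sub>R e, t)" p x] t tT by (simp add: algebra_simps)
  qed
  moreover have "\<bar>F x t (V (x + \<rho> t *\<^sub>R e, t)) p - F x t (?W (x,t)) p\<bar> \<le> K3 * \<bar>\<eta> t\<bar>"
    using F3[of t x "V (x + \<rho> t *\<^sub>R e, t)" p "?W (x,t)"] t tT e(2) by simp
  moreover note \<eta>(3)[OF t]
  ultimately show "\<sigma> * snd (G (x,t)) + F x t (?W (x,t)) (fst (G (x,t))) \<le> 0"
    unfolding G fst_conv snd_conv by linarith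
qed

section \<open>Testing from above and from below\<close>

text \<open>Separates the closed convex epigraph from a point \<epsilon> below the graph. As that
  point lies vertically below, the separating functional has a positive last component and can be
  normalised.\<close>

lemma convex_approx_subgradient:
  fixes F :: "'a::euclidean_space \<Rightarrow> real"
  assumes "convex_on UNIV F" "continuous_on UNIV F" "\<epsilon> > 0"
  obtains b where "\<And>p. F p \<ge> F p0 - \<epsilon> + b \<bullet> (p - p0)"
proof -
  define E where "E = {z. F (fst z) \<le> snd z}"
  have "epigraph UNIV F = E" by (auto simp: epigraph_def E_def)
  then have "convex E" using assms(1) convex_epigraph[of UNIV F] by simp
  moreover have "closed E"
    unfolding E_def by (intro closed_Collect_le continuous_intros continuous_on_compose2[OF assms(2)]) auto
  moreover have "(p0, F p0 - \<epsilon>) \<notin> E" using assms(3) by (simp add: E_def)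
  ultimately obtain a c where ac: "a \<bullet> (p0, F p0 - \<epsilon>) < c" "\<And>z. z \<in> E \<Longrightarrow> a \<bullet> z > c"
    using separating_hyperplane_closed_point[of E "(p0, F p0 - \<epsilon>)"] by blast
  obtain a1 a2 where a: "a = (a1,a2)" by (cases a)
  have sep: "a1 \<bullet> p0 + a2 * (F p0 - \<epsilon>) < a1 \<bullet> p + a2 * F p" for p
    using ac(1) ac(2)[of "(p, F p)"] by (simp add: a E_def)
  have "a2 * \<epsilon> > 0" using sep[of p0] by (simp add: algebra_simps)
  then have a2: "a2 > 0" using assms(3) by (simp add: zero_less_mult_iff)
  show thesis
  proof (rule that)
    fix p
    have "a2 * (F p0 - \<epsilon> + (- (a1 /\<^sub>R a2)) \<bullet> (p - p0)) = a1 \<bullet> p0 + a2 * (F p0 - \<epsilon>) - a1 \<bullet> p"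
      using a2 by (simp add: inner_diff_right field_simps)
    also have "\<dots> < a2 * F p" using sep[of p] by linarith
    finally show "F p0 - \<epsilon> + (- (a1 /\<^sub>R a2)) \<bullet> (p - p0) \<le> F p" using a2 by simp
  qed
qed

text \<open>Confines the gradients of all functions touching from above to one compact ball, on
  which the coefficients of the Hamiltonian can be frozen uniformly.\<close>

lemma touching_lipschitz_gradient_le:
  fixes V :: "'a::euclidean_space \<times> real \<Rightarrow> real"
  assumes "C1_grad_on (UNIV \<times> {0<..<T}) \<phi> G" "0 < t" "t < T" "L \<ge> 0"
    and lip: "\<And>x y. \<bar>V (x,t) - V (y,t)\<bar> \<le> L * dist x y"
    and touch: "\<epsilon> > 0" "\<forall>z\<in>ball (x,t) \<epsilon> \<inter> UNIV \<times> {0<..<T}. V z - \<phi> z \<le> V (x,t) - \<phi> (x,t)"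
  shows "norm (fst (G (x,t))) \<le> L"
proof -
  define p where "p = fst (G (x,t))"
  have "(\<phi> has_derivative (\<lambda>h. G (x,t) \<bullet> h)) (at (x,t))"
    by (rule C1_grad_on_has_derivative[OF assms(1)]) (use assms(2,3) in auto)
  then have "((\<lambda>z. - \<phi> z) has_derivative (\<lambda>h. (- G (x,t)) \<bullet> h)) (at (x,t))"
    using has_derivative_minus by fastforce
  moreover have "\<forall>\<^sub>F h in at_right 0. (\<lambda>z. - \<phi> z) ((x,t) + h *\<^sub>R (- p, 0)) - (- \<phi> (x,t)) \<le> (L * norm p) * h"
    using eventually_at_right_in_ball[OF touch(1), of "(x,t)" "(- p, 0)"] eventually_at_right_less[of 0]
  proof eventually_elim
    case (elim h)
    have eq: "(x,t) + h *\<^sub>R (- p, 0) = (x - h *\<^sub>R p, t)" by simp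
    have "V (x - h *\<^sub>R p, t) - \<phi> (x - h *\<^sub>R p, t) \<le> V (x,t) - \<phi> (x,t)"
      using touch(2) elim(1) assms(2,3) unfolding eq by auto
    moreover have "V (x,t) - V (x - h *\<^sub>R p, t) \<le> L * norm p * h"
      using lip[of x "x - h *\<^sub>R p"] elim(2) by (simp add: dist_norm mult_ac)
    ultimately show ?case unfolding eq by simp
  qed
  ultimately have "(- G (x,t)) \<bullet> (- p, 0) \<le> L * norm p" by (rule gradient_directional_le)
  then have "norm p * norm p \<le> L * norm p"
    by (simp add: inner_prod_def p_def flip: power2_norm_eq_inner power2_eq_square)
  then show ?thesis using assms(4) unfolding p_def by (cases "norm (fst (G (x,t))) = 0") auto
qed

text \<open>For functions that are Lipschitz in space and Hamiltonians convex in the gradient, testing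
  from above and testing from below are equivalent: a supporting affine function of the
  Hamiltonian yields a transport inequality, i.e. a bound on the growth of \<open>V\<close> along the line in
  direction \<open>(b, \<sigma>)\<close>, and this bound does not refer to the kind of test function any more.\<close>

lemma visc_ineq_reverse:
  fixes V :: "'a::euclidean_space \<times> real \<Rightarrow> real"
  assumes V: "visc_ineq T T' \<sigma> F V" "continuous_on (UNIV \<times> {0..<T}) V" and T': "T' \<le> T" and \<sigma>: "\<sigma> \<noteq> 0"
    and Fc: "continuous_on (UNIV \<times> {0..T} \<times> UNIV \<times> UNIV) (\<lambda>(x,t,r,p). F x t r p)"
    and conv: "\<And>x t r. t \<in> {0..T} \<Longrightarrow> convex_on UNIV (F x t r)"
    and L: "L \<ge> 0" and lip: "\<And>x y t. 0 < t \<Longrightarrow> t < T' \<Longrightarrow> \<bar>V (x,t) - V (y,t)\<bar> \<le> L * dist x y"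
  shows "visc_ineq T T' (- \<sigma>) (\<lambda>x t r p. F x t (- r) (- p)) (\<lambda>z. - V z)"
  unfolding visc_ineq_def minus_minus
proof (intro allI impI, elim conjE exE)
  fix \<phi> G x0 t0 e0
  assume C: "C1_grad_on (UNIV \<times> {0<..<T}) \<phi> G" and t0: "0 < t0" "t0 < T'" and e0: "e0 > 0"
    and touch: "\<forall>z\<in>ball (x0,t0) e0 \<inter> UNIV \<times> {0<..<T}. - V z - \<phi> z \<le> - V (x0,t0) - \<phi> (x0,t0)"
  define z0 where "z0 = (x0,t0)"
  have touch0: "- V z - \<phi> z \<le> - V z0 - \<phi> z0" if "z \<in> ball z0 e0" "z \<in> UNIV \<times> {0<..<T}" for z
    using touch that unfolding z0_def by blast
  define p0 where "p0 = - fst (G z0)"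
  define k where "k = (\<lambda>(z,p). F (fst z) (snd z) (V z) p)"
  define U where "U = (UNIV :: 'a set) \<times> {0<..<T}"
  have VU: "continuous_on U V" using V(2) by (rule continuous_on_subset) (auto simp: U_def)
  have kc: "continuous_on (U \<times> UNIV) k"
  proof -
    have "continuous_on (U \<times> UNIV) (\<lambda>w. (\<lambda>(x,t,r,p). F x t r p) (fst (fst w), snd (fst w), V (fst w), snd w))"
      by (rule continuous_on_compose2[OF Fc])
        (auto intro!: continuous_intros continuous_on_compose2[OF VU] simp: U_def)
    then show ?thesis by (simp add: k_def case_prod_beta')
  qed
  have z0U: "z0 \<in> U" using t0 T' by (simp add: z0_def U_def)
  have "- \<sigma> * snd (G z0) + k (z0,p0) \<le> 0 + \<epsilon>" if "\<epsilon> > 0" for \<epsilon>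
  proof -
    have e2: "\<epsilon> / 2 > 0" using that by simp
    have "convex_on UNIV (\<lambda>p. k (z0,p))" unfolding k_def using conv t0 T' by (simp add: z0_def)
    moreover have "continuous_on UNIV (\<lambda>p. k (z0,p))"
      by (rule continuous_on_compose2[OF kc]) (use z0U in \<open>auto intro!: continuous_intros\<close>)
    ultimately obtain b where b: "\<And>p. k (z0,p) \<ge> k (z0,p0) - \<epsilon> / 2 + b \<bullet> (p - p0)"
      using convex_approx_subgradient[OF _ _ e2, of "\<lambda>p. k (z0,p)" p0] by blast
    have "continuous_on (U \<times> cball 0 L) k" using kc by (rule continuous_on_subset) auto
    \<comment> \<open>Freezes the Hamiltonian at z0, uniformly for all gradients that can
      occur.\<close>
    then obtain X where X: "z0 \<in> X" "open X" "\<forall>z\<in>X \<inter> U. \<forall>p\<in>cball 0 L. dist (k (z,p)) (k (z0,p)) \<le> \<epsilon> / 2"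
      by (rule continuous_on_prod_compactE[OF _ compact_cball z0U e2])
    have "open (X \<inter> UNIV \<times> {0<..<T'})" using X(2) by (intro open_Int open_Times) auto
    moreover have "z0 \<in> X \<inter> UNIV \<times> {0<..<T'}" using X(1) t0 by (simp add: z0_def)
    ultimately obtain r where r: "r > 0" "ball z0 r \<subseteq> X \<inter> UNIV \<times> {0<..<T'}" by (rule openE)
    define v where "v = (b, \<sigma>)"
    \<comment> \<open>Linearising at p0 and freezing at z0 cost \<epsilon> / 2 each, so k (z, q)
      \<ge> b \<bullet> q - c near z0. The inequality for V becomes v \<bullet> G' \<le> c, the
      hypothesis of \<open>decrease_along_line\<close>.\<close>
    define c where "c = b \<bullet> p0 - k (z0,p0) + \<epsilon>"
    have v0: "v \<noteq> 0" using \<sigma> by (simp add: v_def zero_prod_def)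
    have line: "V (z0 + h *\<^sub>R v) \<le> V z0 + c * h" if h: "h > 0" "z0 + h *\<^sub>R v \<in> ball z0 r" for h
    proof -
      have "V (z0 + h *\<^sub>R v) \<le> V z0 + h * c"
      proof (rule decrease_along_line[where U = "ball z0 r" and S = "UNIV \<times> {0<..<T}"])
        show "continuous_on (ball z0 r) V"
          using VU by (rule continuous_on_subset) (use r T' in \<open>auto simp: U_def\<close>)
        show "h *\<^sub>R v \<noteq> 0" using h v0 by simp
        show "closed_segment z0 (z0 + h *\<^sub>R v) \<subseteq> ball z0 r"
          using h r by (intro closed_segment_subset) auto
      next
        fix \<psi> G' z
        assume C': "C1_grad_on (UNIV \<times> {0<..<T}) \<psi> G'" and z: "z \<in> ball z0 r"
          and touch': "\<exists>e>0. \<forall>y\<in>ball z e \<inter> UNIV \<times> {0<..<T}. V y - \<psi> y \<le> V z - \<psi> z"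
        obtain x t where zx: "z = (x,t)" by (cases z)
        have zX: "z \<in> X" and t: "0 < t" "t < T'" using r z zx by auto
        define q where "q = fst (G' z)"
        have "norm q \<le> L"
          using touch' touching_lipschitz_gradient_le[OF C' t(1) _ L lip[OF t]] t T' unfolding q_def zx by auto
        moreover have zU: "z \<in> U" using t T' zx by (simp add: U_def)
        ultimately have "dist (k (z,q)) (k (z0,q)) \<le> \<epsilon> / 2" using X(3) zX by (simp add: dist_norm)
        then have "k (z,q) \<ge> k (z0,q) - \<epsilon> / 2" unfolding dist_real_def by linarith
        moreover have "\<sigma> * snd (G' z) + k (z,q) \<le> 0"
          using V(1) C' t touch' unfolding visc_ineq_def zx k_def q_def by auto
        ultimately have "b \<bullet> q + \<sigma> * snd (G' z) \<le> c"
          using b[of q] unfolding c_def inner_diff_right by linarith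
        then have "h * (b \<bullet> q + \<sigma> * snd (G' z)) \<le> h * c" using h by simp
        then show "(h *\<^sub>R v) \<bullet> G' z \<le> h * c" by (simp add: v_def inner_prod_def q_def algebra_simps)
      qed simp
      then show ?thesis by (simp add: mult.commute)
    qed
    have "\<forall>\<^sub>F h in at_right 0. (\<lambda>z. - \<phi> z) (z0 + h *\<^sub>R v) - (- \<phi> z0) \<le> c * h"
      using eventually_at_right_in_ball[OF e0, of z0 v] eventually_at_right_in_ball[OF r(1), of z0 v]
        eventually_at_right_less[of 0]
    proof eventually_elim
      case (elim h)
      have "z0 + h *\<^sub>R v \<in> UNIV \<times> {0<..<T}" using elim(2) r T' by auto
      then have "- V (z0 + h *\<^sub>R v) - \<phi> (z0 + h *\<^sub>R v) \<le> - V z0 - \<phi> z0"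
        by (rule touch0[OF elim(1)])
      then show ?case using line[OF elim(3,2)] by simp
    qed
    moreover have "((\<lambda>z. - \<phi> z) has_derivative (\<lambda>h. (- G z0) \<bullet> h)) (at z0)"
      by (rule C1_grad_on_has_derivative[OF C1_grad_on_uminus[OF C]]) (use z0U in \<open>simp add: U_def\<close>)
    \<comment> \<open>Up to a constant, - \<phi> touches V from below at z0 and inherits the growth
      bound along v; spelled out, this is the reversed inequality up to \<epsilon>.\<close>
    ultimately have "(- G z0) \<bullet> v \<le> c" by (intro gradient_directional_le[where \<phi> = "\<lambda>z. - \<phi> z"])
    then have "p0 \<bullet> b - \<sigma> * snd (G z0) \<le> c" by (simp add: v_def inner_prod_def p0_def mult.commute)
    then show ?thesis unfolding c_def by (simp add: inner_commute)
  qed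
  then have "- \<sigma> * snd (G z0) + k (z0,p0) \<le> 0" by (rule field_le_epsilon)
  then show "- \<sigma> * snd (G (x0,t0)) + F x0 t0 (V (x0,t0)) (- fst (G (x0,t0))) \<le> 0"
    by (simp add: k_def p0_def z0_def)
qed

section \<open>Gradient estimates\<close>

locale hj_solution = hamiltonian H T C1 \<beta> A2 B2 K3
  for H :: "'a::euclidean_space \<Rightarrow> real \<Rightarrow> real \<Rightarrow> 'a \<Rightarrow> real" and T C1 \<beta> A2 B2 K3 :: real +
  fixes U :: "'a \<times> real \<Rightarrow> real"
  assumes Uc: "continuous_on (UNIV \<times> {0..<T}) U"
    and sub: "visc_ineq T T 1 H U"
    and super: "visc_ineq T T 1 (\<lambda>x t r p. - neg_H x t r p) (\<lambda>z. - U z)"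
begin

text \<open>If \<open>C1 + K3 = 0\<close>, then \<open>C1 = 0\<close> and the quotient is \<open>0\<close>, so both functions are constant and
  solve their differential equations in this case, too.\<close>

definition "growth S t = S * exp ((C1 + K3) * t) + C1 * \<beta> / (C1 + K3) * (exp ((C1 + K3) * t) - 1)"

definition "decay I t = I * exp (- (C1 + K3) * t) - C1 * \<beta> / (C1 + K3) * (1 - exp (- (C1 + K3) * t))"

lemma \<beta>_nonneg: "\<beta> \<ge> 0" using \<beta> by auto

lemma growth_deriv: "(growth S has_real_derivative (C1 + K3) * growth S t + C1 * \<beta>) (at t)"
proof (cases "C1 + K3 = 0")
  case True
  then have "C1 = 0" "K3 = 0" using C1 K3 by auto
  then show ?thesis unfolding growth_def[abs_def] by simp
next
  case False
  define c where "c = C1 + K3"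
  show ?thesis using False unfolding growth_def[abs_def] c_def[symmetric]
    by (auto intro!: derivative_eq_intros simp: field_simps)
qed

lemma decay_deriv: "(decay I has_real_derivative - (C1 + K3) * decay I t - C1 * \<beta>) (at t)"
proof (cases "C1 + K3 = 0")
  case True
  then have "C1 = 0" "K3 = 0" using C1 K3 by auto
  then show ?thesis unfolding decay_def[abs_def] by simp
next
  case False
  define c where "c = C1 + K3"
  show ?thesis using False unfolding decay_def[abs_def] c_def[symmetric]
    by (auto intro!: derivative_eq_intros simp: field_simps)
qed

lemma growth_mono:
  assumes "S \<ge> 0" "s \<le> t"
  shows "growth S s \<le> growth S t"
proof -
  have "(C1 + K3) * s \<le> (C1 + K3) * t" using assms C1 K3 by (intro mult_left_mono) auto
  then have "exp ((C1 + K3) * s) \<le> exp ((C1 + K3) * t)" by simp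
  then show ?thesis
    unfolding growth_def using assms C1 K3 \<beta>_nonneg by (intro add_mono mult_left_mono) auto
qed

lemma growth_nonneg: "S \<ge> 0 \<Longrightarrow> t \<ge> 0 \<Longrightarrow> growth S t \<ge> 0"
  using growth_mono[of S 0 t] by (simp add: growth_def)

lemma decay_antimono:
  assumes "I \<ge> 0" "s \<le> t"
  shows "decay I t \<le> decay I s"
proof -
  have "(C1 + K3) * s \<le> (C1 + K3) * t" using assms C1 K3 by (intro mult_left_mono) auto
  then have e: "exp (- (C1 + K3) * t) \<le> exp (- (C1 + K3) * s)"
    by (simp only: exp_le_cancel_iff mult_minus_left neg_le_iff_le)
  have "I * exp (- (C1 + K3) * t) \<le> I * exp (- (C1 + K3) * s)"
    using e assms by (intro mult_left_mono) auto
  moreover have "C1 * \<beta> / (C1 + K3) * (1 - exp (- (C1 + K3) * s)) \<le> C1 * \<beta> / (C1 + K3) * (1 - exp (- (C1 + K3) * t))"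
    using e C1 K3 \<beta>_nonneg by (intro mult_left_mono) auto
  ultimately show ?thesis unfolding decay_def by linarith
qed

lemma decay_exp_le_one:
  assumes "t \<ge> 0"
  shows "exp (- (C1 + K3) * t) \<le> 1"
  unfolding exp_le_one_iff by (rule mult_nonpos_nonneg) (use assms C1 K3 in auto)

lemma decay_le:
  assumes "t \<ge> 0"
  shows "decay I t \<le> I * exp (- (C1 + K3) * t)"
proof -
  have "C1 * \<beta> / (C1 + K3) * (1 - exp (- (C1 + K3) * t)) \<ge> 0"
    using decay_exp_le_one[OF assms] C1 K3 \<beta>_nonneg by (intro mult_nonneg_nonneg) auto
  then show ?thesis by (simp add: decay_def)
qed

lemma U_slice: "0 \<le> t \<Longrightarrow> t < T \<Longrightarrow> continuous_on UNIV (\<lambda>x. U (x,t))"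
  by (rule continuous_on_compose2[OF Uc]) (auto intro!: continuous_intros)

text \<open>The radius \<rho>(t) = r exp (C1 (t0 - t)) shrinks to r at time t0, so an initial bound
  on the scale r exp (C1 t0) becomes one on the scale r. \<open>init\<close> says that the moving
  supremum starts below U on the base ball, and comparison carries this to the vertex.\<close>

lemma lipschitz_propagation:
  assumes t0: "0 < t0" "t0 < T" and S: "S \<ge> 0" and \<delta>: "\<delta> > 0" and r: "r > 0"
    and init: "\<And>y z. y \<in> cball x0 (Rfun A2 B2 x0 t0 + \<delta>) \<Longrightarrow> z \<in> cball y (r * exp (C1 * t0)) \<Longrightarrow>
        U (z,0) \<le> U (y,0) + S * (r * exp (C1 * t0))"
    and z: "z \<in> cball x0 r"
  shows "U (z,t0) \<le> U (x0,t0) + growth S t0 * r"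
proof -
  define \<rho>0 where "\<rho>0 = r * exp (C1 * t0)"
  define \<rho> where "\<rho> = (\<lambda>t. \<rho>0 * exp (- C1 * t))"
  have \<rho>0: "\<rho>0 > 0" using r by (simp add: \<rho>0_def)
  have \<rho>d: "(\<rho> has_real_derivative - 1 * C1 * \<rho> t) (at t)" for t
    unfolding \<rho>_def by (auto intro!: derivative_eq_intros)
  have \<rho>pos: "\<rho> t > 0" for t using \<rho>0 by (simp add: \<rho>_def)
  define \<eta> where "\<eta> = (\<lambda>t. growth S t * \<rho> t)"
  \<comment> \<open>The term - C1 from \<rho>' cancels C1 in the equation of \<open>growth\<close>;
    what is left is exactly the cost in \<open>visc_ineq_moving_sup\<close>.\<close>
  define \<eta>' where "\<eta>' = (\<lambda>t. (K3 * growth S t + C1 * \<beta>) * \<rho> t)"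
  have \<eta>d: "(\<eta> has_real_derivative \<eta>' t) (at t)" for t
    unfolding \<eta>_def \<eta>'_def
    by (rule DERIV_cong[OF DERIV_mult[OF growth_deriv \<rho>d]]) (simp add: algebra_simps)
  have gc: "continuous_on X (growth S)" for X
    by (intro continuous_at_imp_continuous_on ballI DERIV_isCont[OF growth_deriv])
  have \<rho>c: "continuous_on X \<rho>" for X
    by (intro continuous_at_imp_continuous_on ballI DERIV_isCont[OF \<rho>d])
  define W where "W = moving_sup U \<rho> \<eta>"
  have "visc_ineq T T 1 H W"
    unfolding W_def
  proof (rule visc_ineq_moving_sup[OF sub Uc order_refl _ C1 \<beta>_nonneg H1 H3 \<rho>d \<rho>pos \<eta>d])
    show "continuous_on UNIV \<eta>'" unfolding \<eta>'_def by (intro continuous_intros gc \<rho>c)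
    fix t assume t: "0 < t" "t < T"
    have "\<eta> t \<ge> 0" using growth_nonneg[OF S, of t] \<rho>pos[of t] t by (simp add: \<eta>_def)
    then show "C1 * \<beta> * \<rho> t + K3 * \<bar>\<eta> t\<bar> \<le> 1 * \<eta>' t" by (simp add: \<eta>_def \<eta>'_def algebra_simps)
  qed simp
  moreover have "continuous_on (UNIV \<times> {0..<T}) W"
    unfolding W_def \<eta>_def by (intro continuous_on_moving_sup Uc continuous_intros gc \<rho>c)
  moreover have "W (y,0) \<le> U (y,0)" if y: "y \<in> cball x0 (Rfun A2 B2 x0 t0 + \<delta>)" for y
  proof -
    obtain e where e: "norm e \<le> 1" "W (y,0) = U (y + \<rho> 0 *\<^sub>R e, 0) - \<eta> 0"
      using moving_sup_attained[OF U_slice[OF order_refl T], of \<rho> \<eta> y] unfolding W_def by blast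
    have "y + \<rho> 0 *\<^sub>R e \<in> cball y \<rho>0"
      using e(1) \<rho>0 by (simp add: \<rho>_def dist_norm mult_left_le)
    then have "U (y + \<rho> 0 *\<^sub>R e, 0) \<le> U (y,0) + S * \<rho>0" using init[OF y] by (simp add: \<rho>0_def)
    then show ?thesis using e(2) by (simp add: \<eta>_def \<rho>_def growth_def)
  qed
  ultimately have "W (x0,t0) \<le> U (x0,t0)"
    using comparison_in_cone[OF _ Uc _ super t0 order_refl \<delta>] by blast
  moreover have \<rho>t0: "\<rho> t0 = r" by (simp add: \<rho>_def \<rho>0_def flip: exp_add)
  have "norm ((z - x0) /\<^sub>R r) \<le> 1"
    using z r by (simp add: dist_norm norm_minus_commute divide_simps)
  from moving_sup_upper[OF U_slice[OF less_imp_le[OF t0(1)] t0(2)] this, of x0 \<rho> \<eta>]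
  have "U (z,t0) - \<eta> t0 \<le> W (x0,t0)" using t0 r by (simp add: \<rho>t0 W_def)
  ultimately show ?thesis by (simp add: \<eta>_def \<rho>t0)
qed

text \<open>Supplies the Lipschitz constant in space, uniform in time, on which
  \<open>visc_ineq_reverse\<close> depends. The initial bound holds at every scale, so r = |x - y|
  can be taken at once.\<close>

lemma global_lipschitz:
  assumes L: "L \<ge> 0" and lip: "\<And>x y. \<bar>U (x,0) - U (y,0)\<bar> \<le> L * dist x y" and t: "0 < t" "t < T"
  shows "\<bar>U (x,t) - U (y,t)\<bar> \<le> growth L T * dist x y"
proof -
  have *: "U (x,t) \<le> U (y,t) + growth L T * dist x y" for x y
  proof (cases "x = y")
    case False
    have "U (x,t) \<le> U (y,t) + growth L t * dist x y"
    proof (rule lipschitz_propagation[OF t L, of 1])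
      fix w z :: 'a assume "z \<in> cball w (dist x y * exp (C1 * t))"
      then have "L * dist z w \<le> L * (dist x y * exp (C1 * t))"
        using L by (intro mult_left_mono) (auto simp: dist_commute)
      then show "U (z,0) \<le> U (w,0) + L * (dist x y * exp (C1 * t))"
        using lip[of z w] by linarith
    qed (use False in \<open>auto simp: dist_commute\<close>)
    moreover have "growth L t * dist x y \<le> growth L T * dist x y"
      using growth_mono[OF L, of t T] t by (intro mult_right_mono) auto
    ultimately show ?thesis by linarith
  qed simp
  from *[of x y] *[of y x] show ?thesis by (simp add: dist_commute abs_le_iff)
qed

lemma neg_H_simps: "neg_H x t (- r) (- p) = H x t r p"
  by (simp add: neg_H_def)

text \<open>- W is the minimum of U over balls of growing radius, plus \<eta>. The first reversal
  makes - U an inequality with \<sigma> = - 1, which passes to the moving supremum W; W keeps the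
  Lipschitz constant of U, so a second reversal makes - W a subsolution that can be compared with
  U.\<close>

lemma descent_propagation:
  assumes conv: "\<And>x t r. t \<in> {0..T} \<Longrightarrow> convex_on UNIV (H x t r)"
    and L: "L \<ge> 0" and lip: "\<And>x y. \<bar>U (x,0) - U (y,0)\<bar> \<le> L * dist x y"
    and t0: "0 < t0" "t0 < T" and I: "decay I t0 > 0" and \<delta>: "\<delta> > 0" and r: "r > 0"
    and init: "\<And>y. y \<in> cball x0 (Rfun A2 B2 x0 t0 + \<delta>) \<Longrightarrow>
        \<exists>z\<in>cball y (r * exp (- C1 * t0)). U (z,0) \<le> U (y,0) - I * (r * exp (- C1 * t0))"
  shows "\<exists>z\<in>cball x0 r. U (z,t0) \<le> U (x0,t0) - decay I t0 * r"
proof -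
  define \<rho>0 where "\<rho>0 = r * exp (- C1 * t0)"
  define \<rho> where "\<rho> = (\<lambda>t. \<rho>0 * exp (C1 * t))"
  have \<rho>0: "\<rho>0 > 0" using r by (simp add: \<rho>0_def)
  have \<rho>d: "(\<rho> has_real_derivative - (- 1) * C1 * \<rho> t) (at t)" for t
    unfolding \<rho>_def by (auto intro!: derivative_eq_intros)
  have \<rho>pos: "\<rho> t > 0" for t using \<rho>0 by (simp add: \<rho>_def)
  define \<eta> where "\<eta> = (\<lambda>t. decay I t * \<rho> t)"
  define \<eta>' where "\<eta>' = (\<lambda>t. - (K3 * decay I t + C1 * \<beta>) * \<rho> t)"
  have \<eta>d: "(\<eta> has_real_derivative \<eta>' t) (at t)" for t
    unfolding \<eta>_def \<eta>'_def
    by (rule DERIV_cong[OF DERIV_mult[OF decay_deriv \<rho>d]]) (simp add: algebra_simps)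
  have dc: "continuous_on X (decay I)" for X
    by (intro continuous_at_imp_continuous_on ballI DERIV_isCont[OF decay_deriv])
  have \<rho>c: "continuous_on X \<rho>" for X
    by (intro continuous_at_imp_continuous_on ballI DERIV_isCont[OF \<rho>d])
  have "I * exp (- (C1 + K3) * t0) > 0" using I decay_le[of t0 I] t0 by linarith
  then have I0: "I \<ge> 0" by (simp add: zero_less_mult_iff)
  \<comment> \<open>Comparison needs a horizon strictly beyond t0, and |\<eta>| = \<eta> has to hold
    up to it. Continuity at t0 gives the room, monotonicity covers the earlier times.\<close>
  obtain T' where T': "t0 < T'" "T' \<le> T" "\<And>t. t < T' \<Longrightarrow> decay I t \<ge> 0"
  proof -
    have "(decay I \<longlongrightarrow> decay I t0) (at_right t0)"
      using DERIV_isCont[OF decay_deriv] by (simp add: continuous_at_imp_continuous_at_within continuous_within[symmetric])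
    then have "\<forall>\<^sub>F t in at_right t0. decay I t > 0" using I by (rule order_tendstoD)
    moreover have "\<forall>\<^sub>F t in at_right t0. t0 < t \<and> t < T"
      using eventually_at_right_real[OF t0(2)] by simp
    ultimately have "\<forall>\<^sub>F t in at_right t0. decay I t > 0 \<and> t0 < t \<and> t < T"
      by eventually_elim simp
    then obtain T' where T': "decay I T' > 0" "t0 < T'" "T' < T"
      using eventually_happens'[OF trivial_limit_at_right_real] by blast
    have "decay I t \<ge> 0" if "t < T'" for t using decay_antimono[OF I0, of t T'] that T' by simp
    then show thesis using that[of T'] T' by simp
  qed
  define V where "V = (\<lambda>z. - U z)"
  define W where "W = moving_sup V \<rho> \<eta>"
  define \<Lambda> where "\<Lambda> = growth L T"
  have \<Lambda>: "\<Lambda> \<ge> 0" using growth_nonneg[OF L, of T] T by (simp add: \<Lambda>_def)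
  have Ulip: "\<bar>U (x,t) - U (y,t)\<bar> \<le> \<Lambda> * dist x y" if "0 < t" "t < T" for x y t
    unfolding \<Lambda>_def by (rule global_lipschitz[OF L lip that])
  have Vlip: "\<bar>V (x,t) - V (y,t)\<bar> \<le> \<Lambda> * dist x y" if "0 < t" "t < T" for x y t
    using Ulip[OF that, of x y] by (simp add: V_def abs_minus_commute)
  have Vc: "continuous_on (UNIV \<times> {0..<T}) V" unfolding V_def by (intro continuous_intros Uc)
  have V_slice: "continuous_on UNIV (\<lambda>x. V (x,t))" if "0 \<le> t" "t < T" for t
    unfolding V_def by (intro continuous_intros U_slice that)
  have BJ: "visc_ineq T T (- 1) neg_H V"
    using visc_ineq_reverse[OF sub Uc order_refl _ Hcont conv \<Lambda> Ulip]
    by (simp add: V_def neg_H_def[abs_def])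
  have BJ': "visc_ineq T T' (- 1) neg_H V"
    using BJ T'(2) by (rule visc_ineq_mono)
  have W: "visc_ineq T T' (- 1) neg_H W"
    unfolding W_def
  proof (rule visc_ineq_moving_sup[OF BJ' Vc T'(2) _ C1 \<beta>_nonneg _ _ \<rho>d \<rho>pos \<eta>d])
    show "\<bar>neg_H x t r p - neg_H y t r p\<bar> \<le> C1 * (\<beta> + norm p) * dist x y" if "t \<in> {0..T}" for x y t r p
      using H1[OF that, of x "- r" "- p" y] by (simp add: neg_H_def)
    show "\<bar>neg_H x t r p - neg_H x t s p\<bar> \<le> K3 * \<bar>r - s\<bar>" if "t \<in> {0..T}" for x t r s p
      using H3[OF that, of x "- r" "- p" "- s"] by (simp add: neg_H_def abs_minus_commute)
    show "continuous_on UNIV \<eta>'" unfolding \<eta>'_def by (intro continuous_intros dc \<rho>c)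
    fix t assume t: "0 < t" "t < T'"
    have "\<eta> t \<ge> 0" using T'(3)[OF t(2)] \<rho>pos[of t] by (simp add: \<eta>_def)
    then show "C1 * \<beta> * \<rho> t + K3 * \<bar>\<eta> t\<bar> \<le> - 1 * \<eta>' t" by (simp add: \<eta>_def \<eta>'_def algebra_simps)
  qed simp
  have Wc: "continuous_on (UNIV \<times> {0..<T}) W"
    unfolding W_def \<eta>_def by (intro continuous_on_moving_sup Vc continuous_intros dc \<rho>c)
  have negc: "continuous_on (UNIV \<times> {0..T} \<times> UNIV \<times> UNIV) (\<lambda>(x,t,r,p). neg_H x t r p)"
  proof -
    have "continuous_on (UNIV \<times> {0..T} \<times> UNIV \<times> UNIV)
        (\<lambda>w. (\<lambda>(x,t,r,p). H x t r p) (fst w, fst (snd w), - fst (snd (snd w)), - snd (snd (snd w))))"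
      by (rule continuous_on_compose2[OF Hcont]) (auto intro!: continuous_intros)
    then show ?thesis by (simp add: neg_H_def case_prod_beta')
  qed
  have negconv: "convex_on UNIV (neg_H x t r)" if "t \<in> {0..T}" for x t r
  proof (rule convex_onI)
    fix s :: real and p q :: 'a assume s: "0 < s" "s < 1"
    have "neg_H x t r ((1 - s) *\<^sub>R p + s *\<^sub>R q) = H x t (- r) ((1 - s) *\<^sub>R (- p) + s *\<^sub>R (- q))"
      by (simp add: neg_H_def algebra_simps)
    also have "\<dots> \<le> (1 - s) * H x t (- r) (- p) + s * H x t (- r) (- q)"
      using s by (intro convex_onD[OF conv[OF that]]) auto
    finally show "neg_H x t r ((1 - s) *\<^sub>R p + s *\<^sub>R q) \<le> (1 - s) * neg_H x t r p + s * neg_H x t r q"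
      by (simp add: neg_H_def)
  qed simp
  have "visc_ineq T T' (- (- 1)) (\<lambda>x t r p. neg_H x t (- r) (- p)) (\<lambda>z. - W z)"
  proof (rule visc_ineq_reverse[OF W Wc T'(2) _ negc negconv \<Lambda>])
    fix x y t assume t: "0 < t" "t < T'"
    then have "t < T" using T' by simp
    then show "\<bar>W (x,t) - W (y,t)\<bar> \<le> \<Lambda> * dist x y"
      unfolding W_def using t by (intro moving_sup_lipschitz V_slice Vlip) auto
  qed simp_all
  then have "visc_ineq T T' 1 H (\<lambda>z. - W z)" by (simp add: neg_H_simps)
  moreover have "continuous_on (UNIV \<times> {0..<T}) (\<lambda>z. - W z)" by (intro continuous_intros Wc)
  moreover have "- W (y,0) \<le> U (y,0)" if y: "y \<in> cball x0 (Rfun A2 B2 x0 t0 + \<delta>)" for y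
  proof -
    obtain z where z: "z \<in> cball y \<rho>0" "U (z,0) \<le> U (y,0) - I * \<rho>0" using init[OF y] by (auto simp: \<rho>0_def)
    have "norm ((z - y) /\<^sub>R \<rho>0) \<le> 1"
      using z(1) \<rho>0 by (simp add: dist_norm norm_minus_commute divide_simps)
    from moving_sup_upper[OF V_slice[OF order_refl T] this, of y \<rho> \<eta>]
    have "V (z,0) - \<eta> 0 \<le> W (y,0)" using T \<rho>0 by (simp add: \<rho>_def W_def)
    then show ?thesis using z(2) by (simp add: V_def \<eta>_def \<rho>_def decay_def)
  qed
  moreover have "visc_ineq T T' 1 (\<lambda>x t r p. - neg_H x t r p) (\<lambda>z. - U z)"
    using super T'(2) by (rule visc_ineq_mono)
  ultimately have le: "- W (x0,t0) \<le> U (x0,t0)"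
    using comparison_in_cone[OF _ Uc _ _ t0(1) T'(1,2) \<delta>, of "\<lambda>z. - W z"] by blast
  obtain e where e: "norm e \<le> 1" "W (x0,t0) = V (x0 + \<rho> t0 *\<^sub>R e, t0) - \<eta> t0"
    using moving_sup_attained[OF V_slice[OF less_imp_le[OF t0(1)] t0(2)], of \<rho> \<eta> x0]
    unfolding W_def by blast
  have \<rho>t0: "\<rho> t0 = r" by (simp add: \<rho>_def \<rho>0_def flip: exp_add)
  show ?thesis
  proof (rule bexI[of _ "x0 + r *\<^sub>R e"])
    show "U (x0 + r *\<^sub>R e, t0) \<le> U (x0,t0) - decay I t0 * r"
      using le e(2) by (simp add: V_def \<eta>_def \<rho>t0)
    show "x0 + r *\<^sub>R e \<in> cball x0 r" using e(1) r by (simp add: dist_norm mult_left_le)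
  qed
qed

text \<open>Tests in the direction (p, 0): there the increments of U are at most
  \<open>growth\<close> times the distance, with S slightly above \<open>Sbar\<close>.\<close>

lemma subgradient_le:
  assumes lip: "\<And>x y. \<bar>U (x,0) - U (y,0)\<bar> \<le> L * dist x y"
    and t: "0 < t" "t < T" and p: "p \<in> fst ` subdiff_on (UNIV \<times> {0<..<T}) U (x,t)"
  shows "norm p \<le> growth (Sbar A2 B2 (\<lambda>x. U (x,0)) x t) t"
proof (rule field_le_epsilon)
  fix \<epsilon> :: real assume "\<epsilon> > 0"
  define u0 where "u0 = (\<lambda>x. U (x,0))"
  define Sb where "Sb = Sbar A2 B2 u0 x t"
  \<comment> \<open>\<open>growth\<close> is affine in S with slope exp ((C1 + K3) t), so an excess
    e in S costs exactly \<epsilon>.\<close>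
  define e where "e = \<epsilon> / exp ((C1 + K3) * t)"
  have e: "e > 0" using \<open>\<epsilon> > 0\<close> by (simp add: e_def)
  have R0: "Rfun A2 B2 x t \<ge> 0" by (rule Rfun_nonneg) (use t in simp)
  note ap = Sbar_Ibar_approx[of u0 L e A2 B2 x t, OF _ e R0]
  have u0lip: "\<bar>u0 x - u0 y\<bar> \<le> L * dist x y" for x y unfolding u0_def by (rule lip)
  obtain \<delta> where \<delta>: "\<delta> > 0" "\<And>y q. y \<in> cball x (Rfun A2 B2 x t + \<delta>) \<Longrightarrow> q \<in> subdiff u0 y \<Longrightarrow> norm q \<le> Sb + e"
    using ap(1)[OF u0lip] unfolding Sb_def by blast
  have S0: "Sb + e \<ge> 0" using ap(3)[OF u0lip] e by (simp add: Sb_def)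
  have u0c: "continuous_on UNIV u0" unfolding u0_def using U_slice[of 0] T by simp
  \<comment> \<open>A base point within R + \<delta> / 2 of x and a displacement below \<delta> / 2
    stay in the ball where the subgradients of u0 are bounded.\<close>
  have step: "U (z,t) \<le> U (x,t) + growth (Sb + e) t * r" if "r > 0" "r * exp (C1 * t) < \<delta> / 2" "z \<in> cball x r" for z r
  proof (rule lipschitz_propagation[OF t S0 half_gt_zero[OF \<delta>(1)] that(1) _ that(3)])
    fix y w assume y: "y \<in> cball x (Rfun A2 B2 x t + \<delta> / 2)" and w: "w \<in> cball y (r * exp (C1 * t))"
    have "dist x w \<le> dist x y + dist y w" by (rule dist_triangle)
    then have "w \<in> ball x (Rfun A2 B2 x t + \<delta>)" using y w that(2) by simp
    moreover have "y \<in> ball x (Rfun A2 B2 x t + \<delta>)" using y \<delta>(1) by simp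
    ultimately have "u0 w \<le> u0 y + (Sb + e) * norm (w - y)"
      by (intro subdiff_norm_le_imp_lipschitz[OF u0c]) (auto intro!: \<delta>(2))
    moreover have "(Sb + e) * norm (w - y) \<le> (Sb + e) * (r * exp (C1 * t))"
      using w S0 by (intro mult_left_mono) (auto simp: dist_norm norm_minus_commute)
    ultimately show "U (w,0) \<le> U (y,0) + (Sb + e) * (r * exp (C1 * t))" by (simp add: u0_def)
  qed
  obtain \<tau> where "(p,\<tau>) \<in> subdiff_on (UNIV \<times> {0<..<T}) U (x,t)" using p by force
  then obtain \<phi> G a where C: "C1_grad_on (UNIV \<times> {0<..<T}) \<phi> G" and G: "G (x,t) = (p,\<tau>)" and a: "a > 0"
    and touch: "\<And>z. z \<in> ball (x,t) a \<inter> UNIV \<times> {0<..<T} \<Longrightarrow> U (x,t) - \<phi> (x,t) \<le> U z - \<phi> z"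
    unfolding subdiff_on_def by auto
  have g0: "growth (Sb + e) t \<ge> 0" using growth_nonneg[OF S0] t by simp
  have "norm p \<le> growth (Sb + e) t"
  proof (cases "p = 0")
    case False
    have "((\<lambda>h. h * norm p * exp (C1 * t)) \<longlongrightarrow> 0 * norm p * exp (C1 * t)) (at_right 0)"
      by (intro tendsto_intros)
    then have "\<forall>\<^sub>F h in at_right 0. h * norm p * exp (C1 * t) < \<delta> / 2"
      using \<delta>(1) by (intro order_tendstoD) auto
    then have "\<forall>\<^sub>F h in at_right 0. \<phi> ((x,t) + h *\<^sub>R (p,0)) - \<phi> (x,t) \<le> (growth (Sb + e) t * norm p) * h"
      using eventually_at_right_in_ball[OF a, of "(x,t)" "(p,0)"] eventually_at_right_less[of 0]
    proof eventually_elim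
      case (elim h)
      have eq: "(x,t) + h *\<^sub>R (p,0) = (x + h *\<^sub>R p, t)" by simp
      have "U (x + h *\<^sub>R p, t) \<le> U (x,t) + growth (Sb + e) t * (h * norm p)"
        using elim False by (intro step) (auto simp: dist_norm)
      moreover have "U (x,t) - \<phi> (x,t) \<le> U (x + h *\<^sub>R p, t) - \<phi> (x + h *\<^sub>R p, t)"
        using elim(2) t by (intro touch) (auto simp: eq)
      ultimately show ?case unfolding eq by (simp add: mult_ac)
    qed
    then have "(p,\<tau>) \<bullet> (p,0) \<le> growth (Sb + e) t * norm p"
      using C1_grad_on_has_derivative[OF C, of "(x,t)"] t G
      by (intro gradient_directional_le[of \<phi> "(p,\<tau>)" "(x,t)"]) auto
    then have "norm p * norm p \<le> growth (Sb + e) t * norm p"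
      by (simp flip: power2_norm_eq_inner power2_eq_square)
    then show ?thesis using False by simp
  qed (use g0 in simp)
  also have "\<dots> = growth Sb t + \<epsilon>" by (simp add: growth_def e_def distrib_right)
  finally show "norm p \<le> growth (Sbar A2 B2 (\<lambda>x. U (x,0)) x t) t + \<epsilon>" by (simp add: Sb_def u0_def)
qed

text \<open>The lower point found by \<open>descent_propagation\<close> lies in an unknown
  direction, so no single directional derivative suffices: the test function is expanded to first
  order on a whole small ball, with remainder at most e r.\<close>

lemma subgradient_ge:
  assumes conv: "\<And>x t r. t \<in> {0..T} \<Longrightarrow> convex_on UNIV (H x t r)"
    and lip: "\<And>x y. \<bar>U (x,0) - U (y,0)\<bar> \<le> L * dist x y"
    and t: "0 < t" "t < T" and p: "p \<in> fst ` subdiff_on (UNIV \<times> {0<..<T}) U (x,t)"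
  shows "decay (Ibar A2 B2 (\<lambda>x. U (x,0)) x t) t \<le> norm p"
proof (rule field_le_epsilon)
  fix \<epsilon> :: real assume "\<epsilon> > 0"
  define u0 where "u0 = (\<lambda>x. U (x,0))"
  define Ib where "Ib = Ibar A2 B2 u0 x t"
  \<comment> \<open>One e pays for lowering \<open>Ibar\<close> to I, half of it being the strict
    gap that \<open>subdiff_norm_ge_imp_descent\<close> asks for; the other e pays for the
    first-order remainder.\<close>
  define e where "e = \<epsilon> / 2"
  have e: "e > 0" "e / 2 > 0" using \<open>\<epsilon> > 0\<close> by (auto simp: e_def)
  have R0: "Rfun A2 B2 x t \<ge> 0" by (rule Rfun_nonneg) (use t in simp)
  have u0lip: "\<bar>u0 x - u0 y\<bar> \<le> L * dist x y" for x y unfolding u0_def by (rule lip)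
  obtain \<delta> where \<delta>: "\<delta> > 0" "\<And>y q. y \<in> cball x (Rfun A2 B2 x t + \<delta>) \<Longrightarrow> q \<in> subdiff u0 y \<Longrightarrow> norm q \<ge> Ib - e / 2"
    using Sbar_Ibar_approx(2)[OF u0lip e(2) R0] unfolding Ib_def by blast
  have u0c: "continuous_on UNIV u0" unfolding u0_def using U_slice[of 0] T by simp
  have lip': "\<bar>U (x,0) - U (y,0)\<bar> \<le> \<bar>L\<bar> * dist x y" for x y
    by (rule order_trans[OF lip mult_right_mono]) auto
  define I where "I = Ib - e"
  obtain \<tau> where "(p,\<tau>) \<in> subdiff_on (UNIV \<times> {0<..<T}) U (x,t)" using p by force
  then obtain \<phi> G a where C: "C1_grad_on (UNIV \<times> {0<..<T}) \<phi> G" and G: "G (x,t) = (p,\<tau>)" and a: "a > 0"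
    and touch: "\<And>z. z \<in> ball (x,t) a \<inter> UNIV \<times> {0<..<T} \<Longrightarrow> U (x,t) - \<phi> (x,t) \<le> U z - \<phi> z"
    unfolding subdiff_on_def by auto
  have "decay I t \<le> norm p + e"
  proof (cases "decay I t > 0")
    case True
    have "(\<phi> has_derivative (\<lambda>h. (p,\<tau>) \<bullet> h)) (at (x,t))"
      using C1_grad_on_has_derivative[OF C, of "(x,t)"] t G by simp
    then obtain d where d: "d > 0" "\<And>z. norm (z - (x,t)) < d \<Longrightarrow>
        norm (\<phi> z - \<phi> (x,t) - (p,\<tau>) \<bullet> (z - (x,t))) \<le> e * norm (z - (x,t))"
      using e(1) unfolding has_derivative_at_alt by blast
    define r where "r = min (min (d / 2) (a / 2)) (\<delta> / 4)"
    have r: "r > 0" "r < d" "r < a" "r < \<delta> / 2" using d(1) a \<delta>(1) by (auto simp: r_def min_def)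
    have r': "r * exp (- C1 * t) > 0" "r * exp (- C1 * t) < \<delta> / 2"
    proof -
      show "r * exp (- C1 * t) > 0" using r by simp
      have "r * exp (- C1 * t) \<le> r * 1" using r C1 t by (intro mult_left_mono) auto
      then show "r * exp (- C1 * t) < \<delta> / 2" using r by linarith
    qed
    have "\<exists>z\<in>cball x r. U (z,t) \<le> U (x,t) - decay I t * r"
    proof (rule descent_propagation[OF conv _ lip' t True half_gt_zero[OF \<delta>(1)] r(1)])
      fix y assume y: "y \<in> cball x (Rfun A2 B2 x t + \<delta> / 2)"
      obtain z where "z \<in> cball y (r * exp (- C1 * t))" "u0 z \<le> u0 y - I * (r * exp (- C1 * t))"
      proof (rule subdiff_norm_ge_imp_descent[OF u0c r'(1), of I "Ib - e / 2" y])
        show "I < Ib - e / 2" using e by (simp add: I_def)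
        fix z q assume z: "z \<in> ball y (r * exp (- C1 * t))" and q: "q \<in> subdiff u0 z"
        have "dist x z \<le> dist x y + dist y z" by (rule dist_triangle)
        then have "z \<in> cball x (Rfun A2 B2 x t + \<delta>)" using y z r'(2) by simp
        then show "Ib - e / 2 \<le> norm q" using \<delta>(2) q by blast
      qed
      then show "\<exists>z\<in>cball y (r * exp (- C1 * t)). U (z,0) \<le> U (y,0) - I * (r * exp (- C1 * t))"
        unfolding u0_def by blast
    qed simp_all
    then obtain z where z: "z \<in> cball x r" "U (z,t) \<le> U (x,t) - decay I t * r" by blast
    have nz: "norm ((z,t) - (x,t)) = norm (z - x)" by (simp add: norm_Pair)
    have zr: "norm (z - x) \<le> r" using z(1) by (simp add: dist_norm norm_minus_commute)
    have "(z,t) \<in> ball (x,t) a"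
      using zr r(3) by (simp add: dist_Pair_Pair dist_norm norm_minus_commute)
    then have "\<phi> (z,t) - \<phi> (x,t) \<le> - decay I t * r" using touch[of "(z,t)"] t z(2) by auto
    moreover have "\<bar>\<phi> (z,t) - \<phi> (x,t) - p \<bullet> (z - x)\<bar> \<le> e * norm (z - x)"
      using d(2)[of "(z,t)"] zr r(2) unfolding nz by simp
    moreover have "e * norm (z - x) \<le> e * r" using zr e by (intro mult_left_mono) auto
    moreover have "\<bar>p \<bullet> (z - x)\<bar> \<le> norm p * r"
      by (rule order_trans[OF Cauchy_Schwarz_ineq2 mult_left_mono[OF zr]]) simp
    ultimately have "decay I t * r \<le> norm p * r + e * r" by linarith
    then have "decay I t * r \<le> (norm p + e) * r" by (simp add: distrib_right)
    then show ?thesis using r(1) by simp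
  next
    case False
    then show ?thesis using e(1) norm_ge_zero[of p] by linarith
  qed
  moreover have "decay Ib t = decay I t + e * exp (- (C1 + K3) * t)"
    by (simp add: decay_def I_def algebra_simps)
  moreover have "e * exp (- (C1 + K3) * t) \<le> e * 1"
    using decay_exp_le_one[of t] e t by (intro mult_left_mono) auto
  ultimately have "decay Ib t \<le> norm p + \<epsilon>" unfolding e_def by linarith
  then show "decay (Ibar A2 B2 (\<lambda>x. U (x,0)) x t) t \<le> norm p + \<epsilon>" by (simp add: Ib_def u0_def)
qed

end

section \<open>Passage from viscosity solutions to the locale, and the final estimate\<close>

lemma viscosity_solution_imp_hj_solution:
  assumes "hamiltonian H T C1 \<beta> A2 B2 K3" and visc: "viscosity_solution T H u0 u"
  shows "hj_solution H T C1 \<beta> A2 B2 K3 (\<lambda>(y,s). u y s)"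
proof -
  interpret hamiltonian H T C1 \<beta> A2 B2 K3 by fact
  let ?U = "\<lambda>(y,s). u y s"
  show ?thesis
  proof
    show "continuous_on (UNIV \<times> {0..<T}) ?U"
      using visc by (simp add: viscosity_solution_def)
    have V: "((\<exists>e>0. \<forall>z\<in>ball (x,t) e \<inter> (UNIV \<times> {0<..<T}). ?U z - \<phi> z \<le> u x t - \<phi> (x,t))
           \<longrightarrow> snd (G (x,t)) + H x t (u x t) (fst (G (x,t))) \<le> 0) \<and>
        ((\<exists>e>0. \<forall>z\<in>ball (x,t) e \<inter> (UNIV \<times> {0<..<T}). ?U z - \<phi> z \<ge> u x t - \<phi> (x,t))
           \<longrightarrow> snd (G (x,t)) + H x t (u x t) (fst (G (x,t))) \<ge> 0)"
      if "C1_grad_on (UNIV \<times> {0<..<T}) \<phi> G" "0 < t" "t < T" for \<phi> G x t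
      using visc that unfolding viscosity_solution_def by blast
    show "visc_ineq T T 1 H ?U"
      unfolding visc_ineq_def
    proof (intro allI impI, elim conjE)
      fix \<phi> G x t
      assume C: "C1_grad_on (UNIV \<times> {0<..<T}) \<phi> G" "0 < t" "t < T"
        and "\<exists>e>0. \<forall>z\<in>ball (x,t) e \<inter> UNIV \<times> {0<..<T}. ?U z - \<phi> z \<le> ?U (x,t) - \<phi> (x,t)"
      then show "1 * snd (G (x,t)) + H x t (?U (x,t)) (fst (G (x,t))) \<le> 0"
        using V[OF C, of x] by simp
    qed
    show "visc_ineq T T 1 (\<lambda>x t r p. - neg_H x t r p) (\<lambda>z. - ?U z)"
      unfolding visc_ineq_def
    proof (intro allI impI, elim conjE)
      fix \<phi> G x t
      assume C: "C1_grad_on (UNIV \<times> {0<..<T}) \<phi> G" "0 < t" "t < T"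
        and "\<exists>e>0. \<forall>z\<in>ball (x,t) e \<inter> UNIV \<times> {0<..<T}. - ?U z - \<phi> z \<le> - ?U (x,t) - \<phi> (x,t)"
      then obtain e where "e > 0" and touch: "\<forall>z\<in>ball (x,t) e \<inter> UNIV \<times> {0<..<T}. - ?U z - \<phi> z \<le> - ?U (x,t) - \<phi> (x,t)"
        by blast
      have "?U z - - \<phi> z \<ge> u x t - - \<phi> (x,t)" if "z \<in> ball (x,t) e \<inter> UNIV \<times> {0<..<T}" for z
        using bspec[OF touch that] by simp
      then have "\<exists>e>0. \<forall>z\<in>ball (x,t) e \<inter> UNIV \<times> {0<..<T}. ?U z - - \<phi> z \<ge> u x t - - \<phi> (x,t)"
        using \<open>e > 0\<close> by blast
      then have "snd (- G (x,t)) + H x t (u x t) (fst (- G (x,t))) \<ge> 0"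
        using V[OF C1_grad_on_uminus[OF C(1)] C(2,3), of x] by blast
      then show "1 * snd (G (x,t)) + - neg_H x t (- ?U (x,t)) (fst (G (x,t))) \<le> 0"
        by (simp add: neg_H_def)
    qed
  qed
qed

theorem theorem1p4:
  fixes H :: "'a::euclidean_space \<Rightarrow> real \<Rightarrow> real \<Rightarrow> 'a \<Rightarrow> real"
    and u0 :: "'a \<Rightarrow> real" and u :: "'a \<Rightarrow> real \<Rightarrow> real"
    and T C1 \<beta> A2 B2 K3 :: real
  assumes T: "T > 0"
    and Hcont: "continuous_on (UNIV \<times> {0..T} \<times> UNIV \<times> UNIV) (\<lambda>(x,t,r,p). H x t r p)"
    and u0_lip: "\<exists>L. \<forall>x y. \<bar>u0 x - u0 y\<bar> \<le> L * dist x y"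
    and H1: "C1 \<ge> 0" "\<beta> = 0 \<or> \<beta> = 1"
      "\<And>x y t r p. t \<in> {0..T} \<Longrightarrow> \<bar>H x t r p - H y t r p\<bar> \<le> C1 * (\<beta> + norm p) * dist x y"
    and H2: "A2 \<ge> 0" "B2 \<ge> 0"
      "\<And>x t r p q. t \<in> {0..T} \<Longrightarrow> \<bar>H x t r p - H x t r q\<bar> \<le> (A2 * norm x + B2) * dist p q"
    and H3: "K3 \<ge> 0"
      "\<And>x t r s p. t \<in> {0..T} \<Longrightarrow> \<bar>H x t r p - H x t s p\<bar> \<le> K3 * \<bar>r - s\<bar>"
    and H4: "\<And>x t r. t \<in> {0..T} \<Longrightarrow> convex_on UNIV (H x t r)"
    and visc: "viscosity_solution T H u0 u"
  shows
    "((C1, K3) \<noteq> (0, 0) \<longrightarrow>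
       (\<forall>x t p. 0 < t \<and> t < T \<and> p \<in> subdiff_x T u x t \<longrightarrow>
          Ibar A2 B2 u0 x t * exp (-(C1 + K3) * t)
            - C1 * \<beta> / (C1 + K3) * (1 - exp (-(C1 + K3) * t)) \<le> norm p \<and>
          norm p \<le> Sbar A2 B2 u0 x t * exp ((C1 + K3) * t)
            + C1 * \<beta> / (C1 + K3) * (exp ((C1 + K3) * t) - 1))) \<and>
     ((C1, K3) = (0, 0) \<longrightarrow>
       (\<forall>x t p. 0 < t \<and> t < T \<and> p \<in> subdiff_x T u x t \<longrightarrow>
          Ibar A2 B2 u0 x t \<le> norm p \<and> norm p \<le> Sbar A2 B2 u0 x t))"
proof -
  interpret hamiltonian H T C1 \<beta> A2 B2 K3
    by unfold_locales (fact assms)+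
  define U where "U = (\<lambda>(y,s). u y s)"
  interpret hj_solution H T C1 \<beta> A2 B2 K3 U
    unfolding U_def by (rule viscosity_solution_imp_hj_solution[OF hamiltonian_axioms visc])
  have U0: "(\<lambda>x. U (x,0)) = u0"
    using visc by (simp add: U_def viscosity_solution_def fun_eq_iff)
  obtain L where L: "\<And>x y. \<bar>u0 x - u0 y\<bar> \<le> L * dist x y" using u0_lip by blast
  have lip: "\<bar>U (x,0) - U (y,0)\<bar> \<le> L * dist x y" for x y
    using L[of x y] by (simp flip: U0)
  have est: "decay (Ibar A2 B2 u0 x t) t \<le> norm p \<and> norm p \<le> growth (Sbar A2 B2 u0 x t) t"
    if t: "0 < t" "t < T" and p: "p \<in> subdiff_x T u x t" for x t p
  proof -
    have "p \<in> fst ` subdiff_on (UNIV \<times> {0<..<T}) U (x,t)"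
      using p by (simp add: subdiff_x_def U_def)
    then show ?thesis
      using subgradient_ge[OF H4 lip t] subgradient_le[OF lip t] unfolding U0 by blast
  qed
  note est = est[unfolded growth_def decay_def]
  show ?thesis
  proof (intro conjI impI allI; elim conjE)
    fix x t p assume "0 < t" "t < T" "p \<in> subdiff_x T u x t"
    from est[OF this]
    show "Ibar A2 B2 u0 x t * exp (-(C1 + K3) * t) - C1 * \<beta> / (C1 + K3) * (1 - exp (-(C1 + K3) * t)) \<le> norm p"
      "norm p \<le> Sbar A2 B2 u0 x t * exp ((C1 + K3) * t) + C1 * \<beta> / (C1 + K3) * (exp ((C1 + K3) * t) - 1)"
      by blast+
  next
    fix x t p assume "0 < t" "t < T" "p \<in> subdiff_x T u x t"
    \<comment> \<open>Here the division by zero gives 0 and the exponentials are 1, so the general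
      estimate is already the claim.\<close>
    from est[OF this] show "(C1, K3) = (0, 0) \<Longrightarrow> Ibar A2 B2 u0 x t \<le> norm p"
      "(C1, K3) = (0, 0) \<Longrightarrow> norm p \<le> Sbar A2 B2 u0 x t"
      by simp_all
  qed
qed

end
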